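(* Let $\pi:E\to Q$ be a fibred manifold with $\dim Q=n$, fibre dimension $m$, let $r\ge1$, and let $(x^i,u^\alpha_I)$, $|I|\le r$, be adapted coordinates on $U\subset J^r\pi$. Consider the local splitting $$\mathcal C^r_\pi|_U=\mathcal H^r_\pi\oplus\mathcal G^r_\pi|_U,\qquad \mathcal H^r_\pi=\langle D_1,\dots,D_n\rangle,\qquad \mathcal G^r_\pi=\ker T\pi_{r,r-1}.$$ Let $\boldsymbol\eta^r_\pi=\sum_{\alpha}\sum_{|J|\le r-1}\eta^\alpha_J\otimes e^J_\alpha$ be the adapted local $N^r_\pi$-contact form associated with the Reeb frame $R^J_\alpha$ ($|J|\le r-1$, $\alpha=1,\dots,m$) on $U$, and let $\mathfrak R$ be the Reeb lift, the linear map $\mathfrak R:\mathbb R^{N^r_\pi}\to\mathfrak X(U)$ with $\mathfrak R(e^J_\alpha)=R^J_\alpha$. Then, for every $h=\sum_i h^iD_i\in\Gamma(\mathcal H^r_\pi)$ and every $A=\sum_\alpha\sum_{|K|=r}A^\alpha_K\,\partial/\partial u^\alpha_K\in\Gamma(\mathcal G^r_\pi)$, $$\mathfrak R\circ d\boldsymbol\eta^r_\pi(h,A)=\sum_{\alpha=1}^m\sum_{|I|=r-1}\Big(\sum_{i=1}^n h^iA^\alpha_{I+\widehat e_i}\Big)\frac{\partial}{\partial u^\alpha_I}.$$ Moreover, put $V=\langle\partial/\partial u^\alpha_J:|J|=r-1,\ \alpha=1,\dots,m\rangle$. For $p\in U$, $x=\pi_r(p)$, $e=\pi_{r,0}(p)$,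 use the identifications $$(\mathcal H^r_\pi)_p\ni D\mapsto T\pi_r(D)\in T_xQ,$$ $$(\mathcal G^r_\pi)_p\ni\sum_{\alpha}\sum_{|I|=r}\lambda^\alpha_I\frac{\partial}{\partial u^\alpha_I}\mapsto\sum_\alpha\sum_{|I|=r}\lambda^\alpha_I\,\odot dx^{\langle I\rangle}\otimes\frac{\partial}{\partial u^\alpha}\in S^rT_x^*Q\otimes V_e\pi,$$ $$V_p\ni\sum_{\alpha}\sum_{|I|=r-1}\lambda^\alpha_I\frac{\partial}{\partial u^\alpha_I}\mapsto\sum_\alpha\sum_{|I|=r-1}\lambda^\alpha_I\,\odot dx^{\langle I\rangle}\otimes\frac{\partial}{\partial u^\alpha}\in S^{r-1}T_x^*Q\otimes V_e\pi.$$ Under these identifications the bilinear map $(h,A)\mapsto\mathfrak R\circ d\boldsymbol\eta^r_\pi(h,A)$ is exactly the algebraic Spencer contraction $(h,A)\mapsto\iota_hA$.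
   Context: $J^r\pi$ is the $r$-th jet bundle ($J^0\pi=E$), $\pi_r:J^r\pi\to Q$, $\pi_{r,s}:J^r\pi\to J^s\pi$ the projections. Adapted coordinates are the jet coordinates induced by fibred coordinates $(x^i,u^\alpha)$; $\widehat e_i$ is the $i$-th unit multi-index; $x^J=\prod_i(x^i)^{j_i}$, $J!=\prod_i j_i!$; multi-index order is componentwise. Total derivatives: $D_i=\frac{\partial}{\partial x^i}+\sum_\alpha\sum_{|I|\le r-1}u^\alpha_{I+\widehat e_i}\frac{\partial}{\partial u^\alpha_I}$. Contact forms: $\theta^\alpha_I=du^\alpha_I-\sum_iu^\alpha_{I+\widehat e_i}dx^i$, $|I|\le r-1$; $\mathcal C^r_\pi=\bigcap\ker\theta^\alpha_I$. $N^r_\pi=m\binom{n+r-1}{r-1}$ and $\{e^J_\alpha\}_{|J|\le r-1}$ is the canonical basis of $\mathbb R^{N^r_\pi}$. The Reeb frame and adapted form are $$R^J_\alpha=\sum_{I\le J}\frac{x^{J-I}}{(J-I)!}\frac{\partial}{\partial u^\alpha_I},\qquad \eta^\alpha_J=\sum_{L\ge J,|L|\le r-1}(-1)^{|L-J|}\frac{x^{L-J}}{(L-J)!}\theta^\alpha_L.$$ $\mathfrak R$ is extended pointwise linearly to $\mathbb R^{N^r_\pi}$-valued functions. $V_e\pi=\ker T_e\pi$. $S^sT_x^*Q$ is the space of totally symmetric covariant $s$-tensors; for a multi-index $J$ with $|J|=s$, $$\odot\,dx^{\langle J\rangle}(X_1,\dots,X_s)=\frac1{J!}\sum_{\sigma\in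 S_s}\big((dx^1)^{\otimes j_1}\otimes\cdots\otimes(dx^n)^{\otimes j_n}\big)(X_{\sigma(1)},\dots,X_{\sigma(s)}).$$ The algebraic Spencer contraction $T_xQ\times S^sT_x^*Q\otimes V_e\pi\to S^{s-1}T_x^*Q\otimes V_e\pi$, $(h,A)\mapsto\iota_hA$, inserts $h$ in one symmetric argument of $A$. *)

theory Defs
  imports "HOL-Analysis.Analysis"
begin

section \<open>Calculus on \<open>\<real>\<^sup>A\<close>\<close>

text \<open>
  For a finite index set \<open>A\<close>, the space \<open>\<real>\<^sup>A\<close> consists of the real functions that vanish outside
  \<open>A\<close>, with the product topology. (The jet coordinates are indexed by a set that depends
  on the order, so a type-indexed space such as \<open>real ^ 'n\<close> does not fit.)
\<close>

definition coord_space :: "'i set \<Rightarrow> ('i \<Rightarrow> real) set" where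
  "coord_space A = {z. \<forall>a. a \<notin> A \<longrightarrow> z a = 0}"

definition unit_vec :: "'i \<Rightarrow> 'i \<Rightarrow> real" where
  "unit_vec a = (\<lambda>b. if b = a then 1 else 0)"

definition lin_span :: "'k set \<Rightarrow> ('k \<Rightarrow> 'i \<Rightarrow> real) \<Rightarrow> ('i \<Rightarrow> real) set" where
  "lin_span S f = {v. \<exists>c. v = (\<lambda>a. \<Sum>k\<in>S. c k * f k a)}"

definition is_direct_sum :: "('i \<Rightarrow> real) set \<Rightarrow> ('i \<Rightarrow> real) set \<Rightarrow> ('i \<Rightarrow> real) set \<Rightarrow> bool" where
  "is_direct_sum C H G \<longleftrightarrow>
     C = {v. \<exists>u\<in>H. \<exists>w\<in>G. v = (\<lambda>a. u a + w a)} \<and> H \<inter> G = {\<lambda>_. 0}"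

definition pd :: "'i \<Rightarrow> (('i \<Rightarrow> real) \<Rightarrow> real) \<Rightarrow> ('i \<Rightarrow> real) \<Rightarrow> real" where
  "pd a f z = deriv (\<lambda>t. f (z(a := t))) (z a)"

text \<open>\<open>C\<^sup>\<infinity>\<close> on a relatively open \<open>S \<subseteq> \<real>\<^sup>A\<close>: all iterated partial derivatives exist and are continuous.\<close>

definition smooth_fun :: "'i set \<Rightarrow> ('i \<Rightarrow> real) set \<Rightarrow> (('i \<Rightarrow> real) \<Rightarrow> real) \<Rightarrow> bool" where
  "smooth_fun A S f \<longleftrightarrow> (\<forall>as\<in>lists A.
     continuous_on S (foldr pd as f) \<and>
     (\<forall>z\<in>S. \<forall>a\<in>A. (\<lambda>t. foldr pd as f (z(a := t))) differentiable (at (z a))))"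


section \<open>Smooth manifolds\<close>

text \<open>
  A chart is a pair of its domain and its coordinate map; the values of the map outside the
  domain are irrelevant. The inverse of the coordinate map \<open>\<phi>\<close> is \<open>inv_into W \<phi>\<close>.
\<close>

type_synonym ('p, 'i) chart = "'p set \<times> ('p \<Rightarrow> 'i \<Rightarrow> real)"

definition is_chart :: "'i set \<Rightarrow> 'p topology \<Rightarrow> ('p, 'i) chart \<Rightarrow> bool" where
  "is_chart A T = (\<lambda>(W, \<phi>).
     openin T W \<and> openin (top_of_set (coord_space A)) (\<phi> ` W) \<and>
     homeomorphic_map (subtopology T W) (top_of_set (\<phi> ` W)) \<phi>)"

definition compatible :: "'i set \<Rightarrow> ('p, 'i) chart \<Rightarrow> ('p, 'i) chart \<Rightarrow> bool" where
  "compatible A = (\<lambda>(W, \<phi>) (W', \<phi>').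
     \<forall>b\<in>A. smooth_fun A (\<phi> ` (W \<inter> W')) (\<lambda>z. \<phi>' (inv_into W \<phi> z) b))"

definition smooth_manifold :: "'i set \<Rightarrow> 'p topology \<Rightarrow> ('p, 'i) chart set \<Rightarrow> bool" where
  "smooth_manifold A T \<A> \<longleftrightarrow>
     finite A \<and> Hausdorff_space T \<and> second_countable T \<and>
     (\<forall>c\<in>\<A>. is_chart A T c) \<and> (\<Union>c\<in>\<A>. fst c) = topspace T \<and>
     (\<forall>c\<in>\<A>. \<forall>d\<in>\<A>. compatible A c d) \<and>
     (\<forall>c. is_chart A T c \<and> (\<forall>d\<in>\<A>. compatible A c d \<and> compatible A d c) \<longrightarrow> c \<in> \<A>)"

text \<open>Smoothness of a map defined on an open subset \<open>N\<close> of the first manifold.\<close>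

definition smooth_map_on ::
  "'i set \<Rightarrow> 'p topology \<Rightarrow> ('p, 'i) chart set \<Rightarrow>
   'k set \<Rightarrow> 's topology \<Rightarrow> ('s, 'k) chart set \<Rightarrow> 'p set \<Rightarrow> ('p \<Rightarrow> 's) \<Rightarrow> bool" where
  "smooth_map_on A T \<A> B T' \<B> N f \<longleftrightarrow>
     openin T N \<and> continuous_map (subtopology T N) T' f \<and>
     (\<forall>(W, \<phi>)\<in>\<A>. \<forall>(W', \<psi>)\<in>\<B>. \<forall>b\<in>B.
        smooth_fun A (\<phi> ` {p \<in> W \<inter> N. f p \<in> W'}) (\<lambda>z. \<psi> (f (inv_into W \<phi> z)) b))"

text \<open>
  Tangent vectors at a point of a chart domain are given by their components with respect to
  the coordinate frame, \<open>v\<close> standing for \<open>\<Sum>a\<in>A. v a \<partial>/\<partial>z\<^sup>a\<close>; thus \<open>\<partial>/\<partial>z\<^sup>a\<close> is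
  \<open>unit_vec a\<close> and the tangent space is \<open>coord_space A\<close>.
  The following is the tangent map of \<open>f\<close> at \<open>p\<close>, in the chart \<open>(W, \<phi>)\<close> around \<open>p\<close> and
  a chart \<open>\<psi>\<close> around \<open>f p\<close>.
\<close>

definition tangent_map ::
  "'i set \<Rightarrow> 'p set \<Rightarrow> ('p \<Rightarrow> 'i \<Rightarrow> real) \<Rightarrow> 'k set \<Rightarrow> ('s \<Rightarrow> 'k \<Rightarrow> real) \<Rightarrow>
   ('p \<Rightarrow> 's) \<Rightarrow> 'p \<Rightarrow> ('i \<Rightarrow> real) \<Rightarrow> 'k \<Rightarrow> real" where
  "tangent_map A W \<phi> B \<psi> f p v =
     (\<lambda>b. if b \<in> B then \<Sum>a\<in>A. v a * pd a (\<lambda>z. \<psi> (f (inv_into W \<phi> z)) b) (\<phi> p) else 0)"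

text \<open>
  A one-form on \<open>W\<close> is a function \<open>\<omega>\<close> with \<open>\<omega> p\<close> linear on the tangent space at \<open>p\<close>. Since
  \<open>d\<omega> = \<Sum>a,b. \<partial>\<^sub>a \<omega>\<^sub>b dz\<^sup>a \<and> dz\<^sup>b\<close>, with the convention
  \<open>(\<alpha> \<and> \<beta>)(v, w) = \<alpha>(v) \<beta>(w) - \<alpha>(w) \<beta>(v)\<close>, we have:
\<close>

definition ext_deriv ::
  "'i set \<Rightarrow> 'p set \<Rightarrow> ('p \<Rightarrow> 'i \<Rightarrow> real) \<Rightarrow> ('p \<Rightarrow> ('i \<Rightarrow> real) \<Rightarrow> real) \<Rightarrow>
   'p \<Rightarrow> ('i \<Rightarrow> real) \<Rightarrow> ('i \<Rightarrow> real) \<Rightarrow> real" where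
  "ext_deriv A W \<phi> \<omega> p v w =
     (\<Sum>a\<in>A. \<Sum>b\<in>A. pd a (\<lambda>z. \<omega> (inv_into W \<phi> z) (unit_vec b)) (\<phi> p) * (v a * w b - w a * v b))"

text \<open>Exterior derivative of a form with values in \<open>\<real>\<^sup>K\<close>, componentwise.\<close>

definition ext_deriv_vec ::
  "'i set \<Rightarrow> 'p set \<Rightarrow> ('p \<Rightarrow> 'i \<Rightarrow> real) \<Rightarrow> ('p \<Rightarrow> ('i \<Rightarrow> real) \<Rightarrow> 'k \<Rightarrow> real) \<Rightarrow>
   'p \<Rightarrow> ('i \<Rightarrow> real) \<Rightarrow> ('i \<Rightarrow> real) \<Rightarrow> 'k \<Rightarrow> real" where
  "ext_deriv_vec A W \<phi> \<omega> p v w = (\<lambda>k. ext_deriv A W \<phi> (\<lambda>q u. \<omega> q u k) p v w)"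

text \<open>Smooth sections over the chart domain \<open>W\<close> of a family \<open>D p\<close> of subspaces of the tangent spaces.\<close>

definition smooth_sections ::
  "'i set \<Rightarrow> 'p set \<Rightarrow> ('p \<Rightarrow> 'i \<Rightarrow> real) \<Rightarrow> ('p \<Rightarrow> ('i \<Rightarrow> real) set) \<Rightarrow> ('p \<Rightarrow> 'i \<Rightarrow> real) set" where
  "smooth_sections A W \<phi> D =
     {Y. (\<forall>p\<in>W. Y p \<in> D p) \<and> (\<forall>a\<in>A. smooth_fun A (\<phi> ` W) (\<lambda>z. Y (inv_into W \<phi> z) a))}"


section \<open>Multi-indices\<close>

definition multi :: "nat \<Rightarrow> (nat \<Rightarrow> nat) set" where
  "multi n = {I. \<forall>i. i \<notin> {1..n} \<longrightarrow> I i = 0}"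

definition mdeg :: "nat \<Rightarrow> (nat \<Rightarrow> nat) \<Rightarrow> nat" where
  "mdeg n I = (\<Sum>i=1..n. I i)"

definition multi_le :: "nat \<Rightarrow> nat \<Rightarrow> (nat \<Rightarrow> nat) set" where
  "multi_le n k = {I \<in> multi n. mdeg n I \<le> k}"

definition multi_eq :: "nat \<Rightarrow> nat \<Rightarrow> (nat \<Rightarrow> nat) set" where
  "multi_eq n k = {I \<in> multi n. mdeg n I = k}"

definition madd1 :: "(nat \<Rightarrow> nat) \<Rightarrow> nat \<Rightarrow> nat \<Rightarrow> nat" where
  "madd1 I i = I(i := Suc (I i))"

definition mfact :: "nat \<Rightarrow> (nat \<Rightarrow> nat) \<Rightarrow> real" where
  "mfact n J = (\<Prod>i=1..n. fact (J i))"

definition mpow :: "nat \<Rightarrow> (nat \<Rightarrow> real) \<Rightarrow> (nat \<Rightarrow> nat) \<Rightarrow> real" where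
  "mpow n x J = (\<Prod>i=1..n. x i ^ J i)"

definition mpd :: "nat \<Rightarrow> (nat \<Rightarrow> nat) \<Rightarrow> ((nat \<Rightarrow> real) \<Rightarrow> real) \<Rightarrow> (nat \<Rightarrow> real) \<Rightarrow> real" where
  "mpd n I f = foldr (\<lambda>i. pd i ^^ I i) [1..<Suc n] f"


section \<open>Fibred manifolds and jet bundles\<close>

text \<open>
  \<open>xc i\<close> labels the coordinate \<open>x\<^sup>i\<close>, and \<open>uc \<alpha> I\<close> the coordinate \<open>u\<^sup>\<alpha>\<^sub>I\<close>.
  The fibre coordinate \<open>u\<^sup>\<alpha>\<close> of the total space is identified with \<open>u\<^sup>\<alpha>\<^sub>0\<close>.
\<close>

datatype coord = xc nat | uc nat "nat \<Rightarrow> nat"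

definition jet_index :: "nat \<Rightarrow> nat \<Rightarrow> nat \<Rightarrow> coord set" where
  "jet_index n m r = xc ` {1..n} \<union> {uc \<alpha> I | \<alpha> I. \<alpha> \<in> {1..m} \<and> I \<in> multi_le n r}"

record ('q, 'e) fibration =
  base_dim :: nat
  fibre_dim :: nat
  base_topology :: "'q topology"
  base_atlas :: "('q, nat) chart set"
  total_topology :: "'e topology"
  total_atlas :: "('e, coord) chart set"
  projection :: "'e \<Rightarrow> 'q"

abbreviation base_index :: "('q, 'e) fibration \<Rightarrow> nat set" where
  "base_index F \<equiv> {1..base_dim F}"

abbreviation total_index :: "('q, 'e) fibration \<Rightarrow> coord set" where
  "total_index F \<equiv> jet_index (base_dim F) (fibre_dim F) 0"

text \<open>A fibred manifold is a surjective submersion.\<close>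

definition fibred_manifold :: "('q, 'e) fibration \<Rightarrow> bool" where
  "fibred_manifold F \<longleftrightarrow>
     smooth_manifold (base_index F) (base_topology F) (base_atlas F) \<and>
     smooth_manifold (total_index F) (total_topology F) (total_atlas F) \<and>
     smooth_map_on (total_index F) (total_topology F) (total_atlas F)
       (base_index F) (base_topology F) (base_atlas F)
       (topspace (total_topology F)) (projection F) \<and>
     projection F ` topspace (total_topology F) = topspace (base_topology F) \<and>
     (\<forall>(W, y)\<in>total_atlas F. \<forall>(V, x)\<in>base_atlas F. \<forall>e\<in>W. projection F e \<in> V \<longrightarrow>
        tangent_map (total_index F) W y (base_index F) x (projection F) e
          ` coord_space (total_index F) = coord_space (base_index F))"

definition fibred_chart ::
  "('q, 'e) fibration \<Rightarrow> ('e, coord) chart \<Rightarrow> ('q, nat) chart \<Rightarrow> bool" where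
  "fibred_chart F = (\<lambda>(W, y) (V, x).
     (W, y) \<in> total_atlas F \<and> (V, x) \<in> base_atlas F \<and> projection F ` W = V \<and>
     (\<forall>e\<in>W. \<forall>i\<in>base_index F. y e (xc i) = x (projection F e) i))"

text \<open>A local section is a pair \<open>(N, s)\<close> of its open domain and a function, irrelevant outside \<open>N\<close>.\<close>

type_synonym ('q, 'e) lsection = "'q set \<times> ('q \<Rightarrow> 'e)"

definition local_section_at :: "('q, 'e) fibration \<Rightarrow> 'q \<Rightarrow> ('q, 'e) lsection \<Rightarrow> bool" where
  "local_section_at F q = (\<lambda>(N, s).
     q \<in> N \<and>
     smooth_map_on (base_index F) (base_topology F) (base_atlas F)
       (total_index F) (total_topology F) (total_atlas F) N s \<and>
     (\<forall>q'\<in>N. projection F (s q') = q'))"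

text \<open>The derivative \<open>\<partial>\<^sup>|\<^sup>I\<^sup>| (u\<^sup>\<alpha> \<circ> s) / \<partial>x\<^sup>I\<close> at \<open>q\<close>.\<close>

definition section_deriv ::
  "('q, 'e) fibration \<Rightarrow> ('e \<Rightarrow> coord \<Rightarrow> real) \<Rightarrow> ('q, nat) chart \<Rightarrow>
   ('q \<Rightarrow> 'e) \<Rightarrow> nat \<Rightarrow> (nat \<Rightarrow> nat) \<Rightarrow> 'q \<Rightarrow> real" where
  "section_deriv F y = (\<lambda>(V, x) s \<alpha> I q.
     mpd (base_dim F) I (\<lambda>z. y (s (inv_into V x z)) (uc \<alpha> (\<lambda>_. 0))) (x q))"

text \<open>
  Equality of \<open>r\<close>-jets at \<open>q\<close>. Agreement of the derivatives up to order \<open>r\<close> in one fibred chart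
  implies agreement in every fibred chart.
\<close>

definition jet_equiv ::
  "('q, 'e) fibration \<Rightarrow> nat \<Rightarrow> 'q \<Rightarrow> ('q, 'e) lsection \<Rightarrow> ('q, 'e) lsection \<Rightarrow> bool" where
  "jet_equiv F r q = (\<lambda>(N, s) (N', s').
     s q = s' q \<and>
     (\<forall>W y V x. fibred_chart F (W, y) (V, x) \<and> s q \<in> W \<longrightarrow>
        (\<forall>\<alpha>\<in>{1..fibre_dim F}. \<forall>I\<in>multi_le (base_dim F) r.
           section_deriv F y (V, x) s \<alpha> I q = section_deriv F y (V, x) s' \<alpha> I q)))"

text \<open>A jet is a pair of its base point and an equivalence class of local sections.\<close>

type_synonym ('q, 'e) jet = "'q \<times> ('q, 'e) lsection set"

definition jet_of :: "('q, 'e) fibration \<Rightarrow> nat \<Rightarrow> 'q \<Rightarrow> ('q, 'e) lsection \<Rightarrow> ('q, 'e) jet" where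
  "jet_of F r q \<sigma> = (q, {\<sigma>'. local_section_at F q \<sigma>' \<and> jet_equiv F r q \<sigma> \<sigma>'})"

definition jet_space :: "('q, 'e) fibration \<Rightarrow> nat \<Rightarrow> ('q, 'e) jet set" where
  "jet_space F r = {jet_of F r q \<sigma> | q \<sigma>. local_section_at F q \<sigma>}"

definition jet_rep :: "('q, 'e) jet \<Rightarrow> ('q, 'e) lsection" where
  "jet_rep j = (SOME \<sigma>. \<sigma> \<in> snd j)"

text \<open>The projections \<open>\<pi>\<^sub>r\<close>, \<open>\<pi>\<^sub>r\<^sub>,\<^sub>0\<close> (with values in \<open>E = J\<^sup>0\<pi>\<close>) and \<open>\<pi>\<^sub>r\<^sub>,\<^sub>s\<close>.\<close>

definition jet_base :: "('q, 'e) jet \<Rightarrow> 'q" where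
  "jet_base j = fst j"

definition jet_total :: "('q, 'e) jet \<Rightarrow> 'e" where
  "jet_total j = snd (jet_rep j) (jet_base j)"

definition jet_proj :: "('q, 'e) fibration \<Rightarrow> nat \<Rightarrow> ('q, 'e) jet \<Rightarrow> ('q, 'e) jet" where
  "jet_proj F s j = jet_of F s (jet_base j) (jet_rep j)"

definition jet_coords ::
  "('q, 'e) fibration \<Rightarrow> nat \<Rightarrow> ('e \<Rightarrow> coord \<Rightarrow> real) \<Rightarrow> ('q, nat) chart \<Rightarrow>
   ('q, 'e) jet \<Rightarrow> coord \<Rightarrow> real" where
  "jet_coords F r y c j = (\<lambda>a. if a \<in> jet_index (base_dim F) (fibre_dim F) r
     then (case a of
             xc i \<Rightarrow> snd c (jet_base j) i
           | uc \<alpha> I \<Rightarrow> section_deriv F y c (snd (jet_rep j)) \<alpha> I (jet_base j))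
     else 0)"

text \<open>
  \<open>U\<close> is an open subset of the domain of the jet coordinates induced by a fibred chart. These
  coordinates are injective on their domain and map it onto an open set, and they generate
  the smooth structure of the jet bundle, so \<open>U\<close> is open iff its coordinate image is.
\<close>

definition adapted_domain ::
  "('q, 'e) fibration \<Rightarrow> nat \<Rightarrow> ('e, coord) chart \<Rightarrow> ('q, nat) chart \<Rightarrow> ('q, 'e) jet set \<Rightarrow> bool" where
  "adapted_domain F r = (\<lambda>(W, y) c U.
     fibred_chart F (W, y) c \<and>
     U \<subseteq> {j \<in> jet_space F r. jet_total j \<in> W} \<and>
     openin (top_of_set (coord_space (jet_index (base_dim F) (fibre_dim F) r)))
       (jet_coords F r y c ` U))"


section \<open>Cartan distribution, adapted contact form and Reeb lift\<close>

text \<open>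
  All objects below are taken at the point with adapted coordinates \<open>z\<close>, i.e. \<open>z (xc i) = x\<^sup>i\<close>
  and \<open>z (uc \<alpha> I) = u\<^sup>\<alpha>\<^sub>I\<close>.
\<close>

definition total_deriv :: "nat \<Rightarrow> nat \<Rightarrow> nat \<Rightarrow> (coord \<Rightarrow> real) \<Rightarrow> nat \<Rightarrow> coord \<Rightarrow> real" where
  "total_deriv n m r z i = (\<lambda>a. unit_vec (xc i) a +
     (\<Sum>\<alpha>=1..m. \<Sum>I\<in>multi_le n (r - 1). z (uc \<alpha> (madd1 I i)) * unit_vec (uc \<alpha> I) a))"

definition contact_form ::
  "nat \<Rightarrow> (coord \<Rightarrow> real) \<Rightarrow> nat \<Rightarrow> (nat \<Rightarrow> nat) \<Rightarrow> (coord \<Rightarrow> real) \<Rightarrow> real" where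
  "contact_form n z \<alpha> I v = v (uc \<alpha> I) - (\<Sum>i=1..n. z (uc \<alpha> (madd1 I i)) * v (xc i))"

definition cartan :: "nat \<Rightarrow> nat \<Rightarrow> nat \<Rightarrow> (coord \<Rightarrow> real) \<Rightarrow> (coord \<Rightarrow> real) set" where
  "cartan n m r z = {v \<in> coord_space (jet_index n m r).
     \<forall>\<alpha>\<in>{1..m}. \<forall>I\<in>multi_le n (r - 1). contact_form n z \<alpha> I v = 0}"

definition horizontal :: "nat \<Rightarrow> nat \<Rightarrow> nat \<Rightarrow> (coord \<Rightarrow> real) \<Rightarrow> (coord \<Rightarrow> real) set" where
  "horizontal n m r z = lin_span {1..n} (total_deriv n m r z)"

text \<open>The space \<open>\<real>\<^sup>N\<close>, with \<open>N = m (n + r - 1 choose r - 1)\<close>, has canonical basis \<open>e\<^sup>J\<^sub>\<alpha> = unit_vec (\<alpha>, J)\<close>,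
  where \<open>(\<alpha>, J)\<close> ranges over the following set.\<close>

definition reeb_index :: "nat \<Rightarrow> nat \<Rightarrow> nat \<Rightarrow> (nat \<times> (nat \<Rightarrow> nat)) set" where
  "reeb_index n m r = {1..m} \<times> multi_le n (r - 1)"

definition reeb_field :: "nat \<Rightarrow> (coord \<Rightarrow> real) \<Rightarrow> nat \<Rightarrow> (nat \<Rightarrow> nat) \<Rightarrow> coord \<Rightarrow> real" where
  "reeb_field n z \<alpha> J = (\<lambda>a. \<Sum>I\<in>{I \<in> multi n. I \<le> J}.
     mpow n (\<lambda>i. z (xc i)) (J - I) / mfact n (J - I) * unit_vec (uc \<alpha> I) a)"

definition reeb_lift ::
  "nat \<Rightarrow> nat \<Rightarrow> nat \<Rightarrow> (coord \<Rightarrow> real) \<Rightarrow> (nat \<times> (nat \<Rightarrow> nat) \<Rightarrow> real) \<Rightarrow> coord \<Rightarrow> real" where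
  "reeb_lift n m r z c = (\<lambda>a. \<Sum>(\<alpha>, J)\<in>reeb_index n m r. c (\<alpha>, J) * reeb_field n z \<alpha> J a)"

definition adapted_component ::
  "nat \<Rightarrow> nat \<Rightarrow> (coord \<Rightarrow> real) \<Rightarrow> nat \<Rightarrow> (nat \<Rightarrow> nat) \<Rightarrow> (coord \<Rightarrow> real) \<Rightarrow> real" where
  "adapted_component n r z \<alpha> J v = (\<Sum>L\<in>{L \<in> multi_le n (r - 1). J \<le> L}.
     (- 1) ^ mdeg n (L - J) * mpow n (\<lambda>i. z (xc i)) (L - J) / mfact n (L - J) * contact_form n z \<alpha> L v)"

definition adapted_form ::
  "nat \<Rightarrow> nat \<Rightarrow> nat \<Rightarrow> (coord \<Rightarrow> real) \<Rightarrow> (coord \<Rightarrow> real) \<Rightarrow> nat \<times> (nat \<Rightarrow> nat) \<Rightarrow> real" where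
  "adapted_form n m r z v = (\<lambda>k. \<Sum>(\<alpha>, J)\<in>reeb_index n m r.
     adapted_component n r z \<alpha> J v * unit_vec (\<alpha>, J) k)"


section \<open>Symmetric tensors and Spencer contraction\<close>

text \<open>
  \<open>S\<^sup>sT\<^sub>x\<^sup>*Q \<otimes> Y\<close> is the space of symmetric \<open>s\<close>-linear maps from \<open>T\<^sub>xQ\<close> to \<open>Y\<close>, where
  \<open>\<tau> \<otimes> w\<close> maps \<open>Xs\<close> to \<open>\<tau>(Xs) w\<close>. Arguments are lists of length \<open>s\<close> of elements
  of \<open>T\<^sub>xQ\<close>, which is \<open>coord_space {1..n}\<close> (components in the base chart); maps
  are \<open>undefined\<close> elsewhere.
\<close>

definition tangent_tuples :: "nat \<Rightarrow> nat \<Rightarrow> (nat \<Rightarrow> real) list set" where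
  "tangent_tuples n s = {Xs. length Xs = s \<and> set Xs \<subseteq> coord_space {1..n}}"

definition sym_tensors ::
  "nat \<Rightarrow> nat \<Rightarrow> (coord \<Rightarrow> real) set \<Rightarrow> ((nat \<Rightarrow> real) list \<Rightarrow> coord \<Rightarrow> real) set" where
  "sym_tensors n s Y = {B \<in> tangent_tuples n s \<rightarrow>\<^sub>E Y.
     (\<forall>Xs\<in>tangent_tuples n s. \<forall>\<sigma>. \<sigma> permutes {..<s} \<longrightarrow> B (permute_list \<sigma> Xs) = B Xs) \<and>
     (\<forall>Xs\<in>tangent_tuples n s. \<forall>k<s. \<forall>X\<in>coord_space {1..n}. \<forall>X'\<in>coord_space {1..n}. \<forall>c d.
        B (Xs[k := (\<lambda>i. c * X i + d * X' i)]) = (\<lambda>a. c * B (Xs[k := X]) a + d * B (Xs[k := X']) a))}"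

text \<open>
  \<open>\<odot>dx\<^sup>\<langle>\<^sup>J\<^sup>\<rangle>\<close>; the list \<open>multi_list n J\<close> contains \<open>j\<^sub>1\<close> times \<open>1\<close>, followed by \<open>j\<^sub>2\<close> times \<open>2\<close>, etc.,
  and \<open>dx\<^sup>i(X) = X i\<close>.
\<close>

definition multi_list :: "nat \<Rightarrow> (nat \<Rightarrow> nat) \<Rightarrow> nat list" where
  "multi_list n J = concat (map (\<lambda>i. replicate (J i) i) [1..<Suc n])"

definition sym_dx :: "nat \<Rightarrow> (nat \<Rightarrow> nat) \<Rightarrow> (nat \<Rightarrow> real) list \<Rightarrow> real" where
  "sym_dx n J Xs = 1 / mfact n J *
     (\<Sum>\<sigma>\<in>{\<sigma>. \<sigma> permutes {..<mdeg n J}}. \<Prod>k<mdeg n J. (Xs ! \<sigma> k) (multi_list n J ! k))"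

text \<open>
  The identification sending \<open>\<Sum> \<lambda>\<^sup>\<alpha>\<^sub>I \<partial>/\<partial>u\<^sup>\<alpha>\<^sub>I\<close> (with \<open>|I| = s\<close>) to
  \<open>\<Sum> \<lambda>\<^sup>\<alpha>\<^sub>I \<odot>dx\<^sup>\<langle>\<^sup>I\<^sup>\<rangle> \<otimes> \<partial>/\<partial>u\<^sup>\<alpha>\<close>.
\<close>

definition sym_ident ::
  "nat \<Rightarrow> nat \<Rightarrow> nat \<Rightarrow> (coord \<Rightarrow> real) \<Rightarrow> (nat \<Rightarrow> real) list \<Rightarrow> coord \<Rightarrow> real" where
  "sym_ident n m s v = restrict (\<lambda>Xs a. \<Sum>\<alpha>=1..m. \<Sum>I\<in>multi_eq n s.
     v (uc \<alpha> I) * sym_dx n I Xs * unit_vec (uc \<alpha> (\<lambda>_. 0)) a) (tangent_tuples n s)"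

definition spencer_contraction ::
  "nat \<Rightarrow> nat \<Rightarrow> (nat \<Rightarrow> real) \<Rightarrow> ((nat \<Rightarrow> real) list \<Rightarrow> coord \<Rightarrow> real) \<Rightarrow>
   (nat \<Rightarrow> real) list \<Rightarrow> coord \<Rightarrow> real" where
  "spencer_contraction n s X B = restrict (\<lambda>Xs. B (X # Xs)) (tangent_tuples n (s - 1))"

text \<open>\<open>V\<^sub>e\<pi> = ker T\<^sub>e\<pi>\<close>, in a fibred chart.\<close>

definition vertical_space ::
  "('q, 'e) fibration \<Rightarrow> ('e, coord) chart \<Rightarrow> ('q, nat) chart \<Rightarrow> 'e \<Rightarrow> (coord \<Rightarrow> real) set" where
  "vertical_space F = (\<lambda>(W, y) (V, x) e. {v \<in> coord_space (total_index F).
     tangent_map (total_index F) W y (base_index F) x (projection F) e v = (\<lambda>_. 0)})"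

text \<open>\<open>T\<^sub>p\<pi>\<^sub>r\<close> and \<open>(\<G>\<^sup>r\<^sub>\<pi>)\<^sub>p = ker T\<^sub>p\<pi>\<^sub>r\<^sub>,\<^sub>r\<^sub>-\<^sub>1\<close>, in adapted coordinates on \<open>U\<close>.\<close>

definition jet_base_tangent ::
  "('q, 'e) fibration \<Rightarrow> nat \<Rightarrow> ('e \<Rightarrow> coord \<Rightarrow> real) \<Rightarrow> ('q, nat) chart \<Rightarrow> ('q, 'e) jet set \<Rightarrow>
   ('q, 'e) jet \<Rightarrow> (coord \<Rightarrow> real) \<Rightarrow> nat \<Rightarrow> real" where
  "jet_base_tangent F r y c U p =
     tangent_map (jet_index (base_dim F) (fibre_dim F) r) U (jet_coords F r y c)
       (base_index F) (snd c) jet_base p"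

definition jet_vertical ::
  "('q, 'e) fibration \<Rightarrow> nat \<Rightarrow> ('e \<Rightarrow> coord \<Rightarrow> real) \<Rightarrow> ('q, nat) chart \<Rightarrow> ('q, 'e) jet set \<Rightarrow>
   ('q, 'e) jet \<Rightarrow> (coord \<Rightarrow> real) set" where
  "jet_vertical F r y c U p = {v \<in> coord_space (jet_index (base_dim F) (fibre_dim F) r).
     tangent_map (jet_index (base_dim F) (fibre_dim F) r) U (jet_coords F r y c)
       (jet_index (base_dim F) (fibre_dim F) (r - 1)) (jet_coords F (r - 1) y c)
       (jet_proj F (r - 1)) p v = (\<lambda>_. 0)}"

end

theory Submission
  imports Defs "HOL-Combinatorics.Multiset_Permutations"
begin

text \<open>
  Everything reduces to two computations in adapted coordinates, one with differential forms and
  one with symmetric tensors.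

  Forms. The adapted form is obtained from the contact forms by a triangular matrix of functions of
  \<open>x\<close>, and the Reeb frame is given by a triangular matrix with entries \<open>x\<^sup>K / K!\<close>; by the
  binomial theorem for \<open>(x - x)\<^sup>K\<close> the two matrices are inverse to each other
  (\<open>reeb_adapted_coeff_inverse\<close>). On Cartan vectors the contact forms vanish, so by the Leibniz rule
  the derivatives of the matrix entries drop out of \<open>d\<eta>\<close>, and the Reeb lift undoes the matrix
  (\<open>reeb_lift_adapted\<close>). What remains is \<open>\<Sum> d\<theta>\<^sup>\<alpha>\<^sub>L \<partial>/\<partial>u\<^sup>\<alpha>\<^sub>L\<close> with
  \<open>d\<theta>\<^sup>\<alpha>\<^sub>L = \<Sum>\<^sub>i dx\<^sup>i \<and> du\<^sup>\<alpha>\<^sub>L\<^sub>+\<^sub>i\<close>. For a horizontal \<open>D\<close> with components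
  \<open>h\<close> and a vertical \<open>B\<close> of pure order \<open>r\<close>, this is the asserted sum over \<open>|L| = r - 1\<close>
  (\<open>reeb_lift_ext_deriv\<close>).

  Tensors. Since \<open>J!\<close> permutations fix a word with multi-index \<open>J\<close>, the tensor
  \<open>\<odot>dx\<^sup>\<langle>\<^sup>J\<^sup>\<rangle>\<close> is the sum of the basis tensors over all distinct words with multi-index \<open>J\<close>
  (\<open>sym_dx_words\<close>). Hence the identifications turn components indexed by multi-indices into the
  components of a symmetric tensor at words. This shows that they are bijective
  (\<open>sym_ident_bij\<close>), and it turns the Spencer contraction into splitting off the first letter of a
  word, which raises the multi-index of the rest by one unit
  (\<open>spencer_contraction_sym_ident\<close>). That is the formula found for the Reeb lift.

  The jet manifold enters through its tangent maps. All projections only forget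
  coordinates, so \<open>T\<pi>\<^sub>r\<close> reads off the \<open>x\<close>-components, and the kernels \<open>\<G>\<^sup>r\<^sub>\<pi>\<close> and
  \<open>V\<^sub>e\<pi>\<close> consist of the vectors in the directions \<open>\<partial>/\<partial>u\<^sup>\<alpha>\<^sub>I\<close> with \<open>|I| = r\<close> and
  \<open>|I| = 0\<close> (\<open>tangent_map_forget_coords\<close>, \<open>jet_vertical_eq\<close>, \<open>vertical_space_eq\<close>).
\<close>

(* Index sets and orders are written with 1 throughout, so it is kept from becoming Suc 0. *)
declare One_nat_def [simp del]

section \<open>Partial derivatives in a chart\<close>

lemma pd_DERIV: "((\<lambda>t. f (z(a := t))) has_real_derivative d) (at (z a)) \<Longrightarrow> pd a f z = d"
  unfolding pd_def by (rule DERIV_imp_deriv)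

lemma DERIV_coord: "((\<lambda>t. (z(a := t)) b) has_real_derivative unit_vec b a) (at (s :: real))"
  by (cases "b = a") (auto simp: unit_vec_def)

lemma pd_coord: "pd a (\<lambda>z. z b) z = unit_vec b a"
  by (rule pd_DERIV) (rule DERIV_coord)

lemma unit_vec_apply [simp]: "unit_vec a a = 1" "b \<noteq> a \<Longrightarrow> unit_vec a b = 0"
  by (simp_all add: unit_vec_def)

lemma unit_vec_commute: "unit_vec a b = unit_vec b a"
  by (simp add: unit_vec_def)

lemma sum_unit_vec:
  assumes "finite A"
  shows "(\<Sum>a\<in>A. f a * unit_vec a b) = (if b \<in> A then f b else 0)"
    and "(\<Sum>a\<in>A. f a * unit_vec b a) = (if b \<in> A then f b else 0)"
proof -
  have "(\<Sum>a\<in>A. f a * unit_vec a b) = (\<Sum>a\<in>A. if b = a then f a else 0)"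
    by (intro sum.cong) (auto simp: unit_vec_def)
  then show 1: "(\<Sum>a\<in>A. f a * unit_vec a b) = (if b \<in> A then f b else 0)"
    using assms by simp
  then show "(\<Sum>a\<in>A. f a * unit_vec b a) = (if b \<in> A then f b else 0)"
    by (simp add: unit_vec_commute[of b])
qed

text \<open>
  Whichever preimage \<open>inv_into\<close> chooses, \<open>\<phi> (inv_into U \<phi> z) = z\<close> on the open set \<open>\<phi> ` U\<close>, which
  contains an interval around \<open>\<phi> p\<close> of each coordinate line through this point.
\<close>

lemma pd_chart:
  assumes op: "openin (top_of_set (coord_space A)) (\<phi> ` U)" and p: "p \<in> U" and a: "a \<in> A"
    and gf: "\<And>q. q \<in> U \<Longrightarrow> g q = f (\<phi> q)"
  shows "pd a (\<lambda>z. g (inv_into U \<phi> z)) (\<phi> p) = pd a f (\<phi> p)"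
proof -
  obtain S where S: "open S" "\<phi> ` U = coord_space A \<inter> S"
    using op by (auto simp: openin_open)
  have "\<phi> p \<in> \<phi> ` U" using p by blast
  then have in_space: "\<phi> p \<in> coord_space A" and in_S: "\<phi> p \<in> S" using S(2) by auto
  have "continuous_on UNIV (\<lambda>t. ((\<phi> p)(a := t)) i)" for i
    by (cases "i = a") (auto intro: continuous_intros)
  then have "continuous_on UNIV (\<lambda>t. (\<phi> p)(a := t))"
    by (rule continuous_on_coordinatewise_then_product)
  then have "open ((\<lambda>t. (\<phi> p)(a := t)) -` S)"
    using S(1) by (simp add: continuous_on_open_vimage)
  then have "\<forall>\<^sub>F t in nhds (\<phi> p a). t \<in> (\<lambda>t. (\<phi> p)(a := t)) -` S"
    using in_S by (intro eventually_nhds_in_open) auto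
  then have "\<forall>\<^sub>F t in nhds (\<phi> p a). g (inv_into U \<phi> ((\<phi> p)(a := t))) = f ((\<phi> p)(a := t))"
  proof eventually_elim
    case (elim t)
    have "(\<phi> p)(a := t) \<in> coord_space A" using in_space a by (auto simp: coord_space_def)
    then have *: "(\<phi> p)(a := t) \<in> \<phi> ` U" using elim S(2) by auto
    then show ?case using gf[OF inv_into_into[OF *]] f_inv_into_f[OF *] by simp
  qed
  then show ?thesis unfolding pd_def by (rule deriv_cong_ev) simp
qed

text \<open>
  Projections of jet bundles and of the total space forget coordinates: each coordinate \<open>b\<close>
  of the image is a coordinate \<open>\<kappa> b\<close> of the source, so the tangent map forgets components.
\<close>

lemma tangent_map_forget_coords:
  assumes "finite A" and "openin (top_of_set (coord_space A)) (\<phi> ` U)" and "p \<in> U"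
    and "\<And>q b. q \<in> U \<Longrightarrow> b \<in> B \<Longrightarrow> \<psi> (f q) b = \<phi> q (\<kappa> b)" and "\<kappa> ` B \<subseteq> A"
  shows "tangent_map A U \<phi> B \<psi> f p v = (\<lambda>b. if b \<in> B then v (\<kappa> b) else 0)"
proof
  fix b
  show "tangent_map A U \<phi> B \<psi> f p v b = (if b \<in> B then v (\<kappa> b) else 0)"
  proof (cases "b \<in> B")
    case True
    have "pd a (\<lambda>z. \<psi> (f (inv_into U \<phi> z)) b) (\<phi> p) = unit_vec (\<kappa> b) a" if "a \<in> A" for a
      using pd_chart[OF assms(2,3) that, of "\<lambda>q. \<psi> (f q) b" "\<lambda>z. z (\<kappa> b)"] assms(4) True
      by (simp add: pd_coord)
    then have "tangent_map A U \<phi> B \<psi> f p v b = (\<Sum>a\<in>A. v a * unit_vec (\<kappa> b) a)"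
      using True by (simp add: tangent_map_def)
    also have "\<dots> = v (\<kappa> b)" using True assms(1,5) by (auto simp: sum_unit_vec)
    finally show ?thesis using True by simp
  qed (simp add: tangent_map_def)
qed


section \<open>Multi-indices and jet coordinates\<close>

lemma finite_multi_le [simp]: "finite (multi_le n k)"
proof (rule finite_subset)
  show "multi_le n k \<subseteq> {I. \<forall>i. (i \<in> {1..n} \<longrightarrow> I i \<in> {0..k}) \<and> (i \<notin> {1..n} \<longrightarrow> I i = 0)}"
  proof
    fix I assume I: "I \<in> multi_le n k"
    have "I i \<le> k" if "i \<in> {1..n}" for i
      using member_le_sum[OF that, of I] I by (simp add: multi_le_def mdeg_def)
    then show "I \<in> {I. \<forall>i. (i \<in> {1..n} \<longrightarrow> I i \<in> {0..k}) \<and> (i \<notin> {1..n} \<longrightarrow> I i = 0)}"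
      using I by (auto simp: multi_le_def multi_def)
  qed
qed (intro finite_set_of_finite_funs finite_atLeastAtMost)

lemma finite_multi_eq [simp]: "finite (multi_eq n k)"
  by (rule finite_subset[OF _ finite_multi_le[of n k]]) (auto simp: multi_eq_def multi_le_def)

lemma multi_le_0 [simp]: "multi_le n 0 = {\<lambda>_. 0}"
  by (force simp: multi_le_def multi_def mdeg_def fun_eq_iff)

lemma multi_eq_subset: "multi_eq n k \<subseteq> multi_le n k"
  by (auto simp: multi_eq_def multi_le_def)

lemma multi_le_mono: "k \<le> l \<Longrightarrow> multi_le n k \<subseteq> multi_le n l"
  by (auto simp: multi_le_def)

lemma multi_eq_conv_le: "1 \<le> r \<Longrightarrow> multi_eq n r = multi_le n r - multi_le n (r - 1)"
  by (auto simp: multi_eq_def multi_le_def)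

lemma mdeg_madd1: "i \<in> {1..n} \<Longrightarrow> mdeg n (madd1 I i) = Suc (mdeg n I)"
proof -
  assume i: "i \<in> {1..n}"
  have "mdeg n (madd1 I i) = (\<Sum>j=1..n. I j + (if j = i then 1 else 0))"
    by (auto simp: mdeg_def madd1_def intro!: sum.cong)
  then show ?thesis using i by (simp add: mdeg_def sum.distrib)
qed

lemma madd1_multi: "I \<in> multi n \<Longrightarrow> i \<in> {1..n} \<Longrightarrow> madd1 I i \<in> multi n"
  by (auto simp: multi_def madd1_def)

lemma madd1_multi_le: "1 \<le> r \<Longrightarrow> I \<in> multi_le n (r - 1) \<Longrightarrow> i \<in> {1..n} \<Longrightarrow> madd1 I i \<in> multi_le n r"
  by (auto simp: multi_le_def mdeg_madd1 madd1_multi simp del: atLeastAtMost_iff)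

lemma madd1_multi_eq_iff:
  "1 \<le> r \<Longrightarrow> I \<in> multi_le n (r - 1) \<Longrightarrow> i \<in> {1..n} \<Longrightarrow>
     madd1 I i \<in> multi_eq n r \<longleftrightarrow> I \<in> multi_eq n (r - 1)"
  by (auto simp: multi_le_def multi_eq_def mdeg_madd1 madd1_multi simp del: atLeastAtMost_iff)

lemma madd1_multi_eq: "1 \<le> r \<Longrightarrow> I \<in> multi_eq n (r - 1) \<Longrightarrow> i \<in> {1..n} \<Longrightarrow> madd1 I i \<in> multi_eq n r"
  using madd1_multi_eq_iff multi_eq_subset by blast

lemma mem_multi_le_of_le:
  assumes "L \<in> multi_le n k" "J \<in> multi n" "J \<le> L"
  shows "J \<in> multi_le n k"
proof -
  have "mdeg n J \<le> mdeg n L" using assms(3) by (auto simp: mdeg_def le_fun_def intro: sum_mono)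
  then show ?thesis using assms by (auto simp: multi_le_def)
qed

lemma finite_jet_index [simp]: "finite (jet_index n m r)"
proof -
  have "{uc \<alpha> I | \<alpha> I. \<alpha> \<in> {1..m} \<and> I \<in> multi_le n r} = (\<lambda>(\<alpha>, I). uc \<alpha> I) ` ({1..m} \<times> multi_le n r)"
    by auto
  then show ?thesis by (simp add: jet_index_def)
qed

lemma jet_index_iff [simp]:
  "xc i \<in> jet_index n m r \<longleftrightarrow> i \<in> {1..n}"
  "uc \<alpha> I \<in> jet_index n m r \<longleftrightarrow> \<alpha> \<in> {1..m} \<and> I \<in> multi_le n r"
  by (auto simp: jet_index_def)

text \<open>
  The fibre of \<open>\<G>\<^sup>r\<^sub>\<pi>\<close>, the space \<open>V\<close> and the vertical space \<open>V\<^sub>e\<pi>\<close> are the cases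
  \<open>s = r\<close>, \<open>s = r - 1\<close> and \<open>s = 0\<close>.
\<close>

definition pure_order :: "nat \<Rightarrow> nat \<Rightarrow> nat \<Rightarrow> (coord \<Rightarrow> real) set" where
  "pure_order n m s = coord_space {uc \<alpha> I | \<alpha> I. \<alpha> \<in> {1..m} \<and> I \<in> multi_eq n s}"

lemma pure_order_xc: "v \<in> pure_order n m s \<Longrightarrow> v (xc i) = 0"
  by (auto simp: pure_order_def coord_space_def)

lemma pure_order_uc: "v \<in> pure_order n m s \<Longrightarrow> \<not> (\<alpha> \<in> {1..m} \<and> I \<in> multi_eq n s) \<Longrightarrow> v (uc \<alpha> I) = 0"
  by (auto simp: pure_order_def coord_space_def)

lemma sum_unit_vec_uc:
  assumes "finite M"
  shows "(\<Sum>\<alpha>=1..m. \<Sum>I\<in>M. c \<alpha> I * unit_vec (uc \<alpha> I) a) =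
    (case a of xc _ \<Rightarrow> 0 | uc \<alpha> I \<Rightarrow> if \<alpha> \<in> {1..m} \<and> I \<in> M then c \<alpha> I else 0)"
proof (cases a)
  case (xc i)
  then show ?thesis by (simp add: unit_vec_def)
next
  case (uc \<beta> K)
  have "(\<Sum>\<alpha>=1..m. \<Sum>I\<in>M. c \<alpha> I * unit_vec (uc \<alpha> I) a) =
      (\<Sum>\<alpha>=1..m. \<Sum>I\<in>M. if K = I then if \<beta> = \<alpha> then c \<alpha> I else 0 else 0)"
    unfolding uc by (intro sum.cong refl) (auto simp: unit_vec_def)
  also have "\<dots> = (\<Sum>\<alpha>=1..m. if \<beta> = \<alpha> then if K \<in> M then c \<alpha> K else 0 else 0)"
    using assms by (intro sum.cong refl) auto
  finally show ?thesis using uc by simp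
qed

lemma lin_span_pure_order:
  "lin_span ({1..m} \<times> multi_eq n s) (\<lambda>(\<alpha>, J). unit_vec (uc \<alpha> J)) = pure_order n m s"
proof -
  have *: "(\<Sum>k\<in>{1..m} \<times> multi_eq n s. c k * (case k of (\<alpha>, J) \<Rightarrow> unit_vec (uc \<alpha> J)) a) =
      (\<Sum>\<alpha>=1..m. \<Sum>J\<in>multi_eq n s. c (\<alpha>, J) * unit_vec (uc \<alpha> J) a)" for c a
    by (simp add: sum.cartesian_product case_prod_beta)
  show ?thesis
  proof (intro equalityI subsetI)
    fix v assume "v \<in> lin_span ({1..m} \<times> multi_eq n s) (\<lambda>(\<alpha>, J). unit_vec (uc \<alpha> J))"
    then obtain c where v: "v = (\<lambda>a. \<Sum>\<alpha>=1..m. \<Sum>J\<in>multi_eq n s. c (\<alpha>, J) * unit_vec (uc \<alpha> J) a)"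
      by (auto simp: lin_span_def *)
    have "v a = 0" if "a \<notin> {uc \<alpha> I | \<alpha> I. \<alpha> \<in> {1..m} \<and> I \<in> multi_eq n s}" for a
      unfolding v sum_unit_vec_uc[OF finite_multi_eq] using that by (cases a) auto
    then show "v \<in> pure_order n m s" by (simp add: pure_order_def coord_space_def)
  next
    fix v assume v: "v \<in> pure_order n m s"
    have "v = (\<lambda>a. \<Sum>k\<in>{1..m} \<times> multi_eq n s. v (uc (fst k) (snd k)) *
        (case k of (\<alpha>, J) \<Rightarrow> unit_vec (uc \<alpha> J)) a)"
    proof
      fix a
      show "v a = (\<Sum>k\<in>{1..m} \<times> multi_eq n s. v (uc (fst k) (snd k)) *
        (case k of (\<alpha>, J) \<Rightarrow> unit_vec (uc \<alpha> J)) a)"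
        unfolding * using pure_order_xc[OF v] pure_order_uc[OF v]
        by (auto simp: sum_unit_vec_uc split: coord.splits)
    qed
    then show "v \<in> lin_span ({1..m} \<times> multi_eq n s) (\<lambda>(\<alpha>, J). unit_vec (uc \<alpha> J))"
      unfolding lin_span_def mem_Collect_eq by (rule exI[of _ "\<lambda>k. v (uc (fst k) (snd k))"])
  qed
qed


section \<open>The splitting of the Cartan distribution\<close>

lemma total_deriv_xc: "total_deriv n m r z i (xc j) = (if j = i then 1 else 0)"
  by (simp add: total_deriv_def unit_vec_def)

lemma total_deriv_uc:
  "total_deriv n m r z i (uc \<alpha> I) = (if \<alpha> \<in> {1..m} \<and> I \<in> multi_le n (r - 1) then z (uc \<alpha> (madd1 I i)) else 0)"
  by (simp add: total_deriv_def sum_unit_vec_uc unit_vec_apply(2)[of "uc \<alpha> I" "xc i"])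

lemma sum_total_deriv_xc: "(\<Sum>i=1..n. h i * total_deriv n m r z i (xc j)) = (if j \<in> {1..n} then h j else 0)"
proof -
  have "(\<Sum>i=1..n. h i * total_deriv n m r z i (xc j)) = (\<Sum>i=1..n. if j = i then h i else 0)"
    by (intro sum.cong) (auto simp: total_deriv_xc)
  then show ?thesis by simp
qed

lemma horizontal_altdef:
  "horizontal n m r z = {v. \<exists>h. v = (\<lambda>a. \<Sum>i=1..n. h i * total_deriv n m r z i a)}"
  by (simp add: horizontal_def lin_span_def)

lemma horizontal_subset_cartan:
  assumes "1 \<le> r" "v \<in> horizontal n m r z"
  shows "v \<in> cartan n m r z"
proof -
  obtain h where v: "v = (\<lambda>a. \<Sum>i=1..n. h i * total_deriv n m r z i a)"
    using assms(2) by (auto simp: horizontal_altdef)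
  have sub: "multi_le n (r - 1) \<subseteq> multi_le n r" by (rule multi_le_mono) simp
  have "total_deriv n m r z i a = 0" if "i \<in> {1..n}" "a \<notin> jet_index n m r" for i a
    using that sub by (cases a) (auto simp: total_deriv_xc total_deriv_uc)
  then have "v \<in> coord_space (jet_index n m r)"
    by (auto simp: v coord_space_def intro!: sum.neutral)
  moreover have "contact_form n z \<alpha> I v = 0" if "\<alpha> \<in> {1..m}" "I \<in> multi_le n (r - 1)" for \<alpha> I
  proof -
    have "(\<Sum>j=1..n. z (uc \<alpha> (madd1 I j)) * v (xc j)) = (\<Sum>j=1..n. h j * z (uc \<alpha> (madd1 I j)))"
      by (intro sum.cong) (auto simp: v sum_total_deriv_xc)
    then show ?thesis using that by (simp add: contact_form_def v total_deriv_uc)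
  qed
  ultimately show ?thesis by (simp add: cartan_def)
qed

lemma pure_order_subset_cartan:
  assumes "1 \<le> r" "v \<in> pure_order n m r"
  shows "v \<in> cartan n m r z"
proof -
  have "{uc \<alpha> I | \<alpha> I. \<alpha> \<in> {1..m} \<and> I \<in> multi_eq n r} \<subseteq> jet_index n m r"
    using multi_eq_subset[of n r] by (auto simp: jet_index_def)
  then have "v \<in> coord_space (jet_index n m r)"
    using assms(2) unfolding pure_order_def coord_space_def by blast
  moreover have "v (uc \<alpha> I) = 0" if "I \<in> multi_le n (r - 1)" for \<alpha> I
    using that assms by (intro pure_order_uc[OF assms(2)]) (auto simp: multi_eq_conv_le)
  ultimately show ?thesis
    by (auto simp: cartan_def contact_form_def pure_order_xc[OF assms(2)])
qed

text \<open>
  A vector of the Cartan distribution is determined by its components \<open>v (xc i)\<close> and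
  \<open>v (uc \<alpha> I)\<close> with \<open>|I| = r\<close>; the first are the components of its horizontal part.
\<close>

lemma cartan_splitting:
  assumes r: "1 \<le> r"
  shows "is_direct_sum (cartan n m r z) (horizontal n m r z) (pure_order n m r)"
  unfolding is_direct_sum_def
proof
  show "cartan n m r z = {v. \<exists>u\<in>horizontal n m r z. \<exists>w\<in>pure_order n m r. v = (\<lambda>a. u a + w a)}"
  proof (intro equalityI subsetI)
    fix v assume v: "v \<in> cartan n m r z"
    define u where "u = (\<lambda>a. \<Sum>i=1..n. v (xc i) * total_deriv n m r z i a)"
    define w where "w = (\<lambda>a. v a - u a)"
    have u: "u \<in> horizontal n m r z" by (auto simp: horizontal_altdef u_def)
    have v0: "v a = 0" if "a \<notin> jet_index n m r" for a
      using v that by (auto simp: cartan_def coord_space_def)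
    have u0: "u a = 0" if "a \<notin> jet_index n m r" for a
      using horizontal_subset_cartan[OF r u] that by (auto simp: cartan_def coord_space_def)
    have "w (xc i) = 0" for i
      using v0[of "xc i"] by (auto simp: w_def u_def sum_total_deriv_xc)
    moreover have "w (uc \<alpha> I) = 0" if I: "\<not> (\<alpha> \<in> {1..m} \<and> I \<in> multi_eq n r)" for \<alpha> I
    proof (cases "\<alpha> \<in> {1..m} \<and> I \<in> multi_le n (r - 1)")
      case True
      then have "v (uc \<alpha> I) = (\<Sum>i=1..n. z (uc \<alpha> (madd1 I i)) * v (xc i))"
        using v by (auto simp: cartan_def contact_form_def)
      then show ?thesis using True by (simp add: w_def u_def total_deriv_uc mult.commute)
    next
      case False
      then have "uc \<alpha> I \<notin> jet_index n m r" using I r by (auto simp: multi_eq_conv_le)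
      then show ?thesis by (simp add: w_def v0 u0)
    qed
    ultimately have "w a = 0" if "\<nexists>\<alpha> I. a = uc \<alpha> I \<and> \<alpha> \<in> {1..m} \<and> I \<in> multi_eq n r" for a
      using that by (cases a) blast+
    then have "w \<in> pure_order n m r" by (simp add: pure_order_def coord_space_def)
    moreover have "v = (\<lambda>a. u a + w a)" by (simp add: w_def)
    ultimately show "v \<in> {v. \<exists>u\<in>horizontal n m r z. \<exists>w\<in>pure_order n m r. v = (\<lambda>a. u a + w a)}"
      using u by blast
  next
    fix v assume "v \<in> {v. \<exists>u\<in>horizontal n m r z. \<exists>w\<in>pure_order n m r. v = (\<lambda>a. u a + w a)}"
    then obtain u w where v: "v = (\<lambda>a. u a + w a)" and "u \<in> cartan n m r z" "w \<in> cartan n m r z"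
      using horizontal_subset_cartan[OF r] pure_order_subset_cartan[OF r] by blast
    then show "v \<in> cartan n m r z"
      by (auto simp: cartan_def coord_space_def contact_form_def distrib_left sum.distrib)
  qed
  show "horizontal n m r z \<inter> pure_order n m r = {\<lambda>_. 0}"
  proof (intro equalityI subsetI)
    fix v assume "v \<in> horizontal n m r z \<inter> pure_order n m r"
    then obtain h where v: "v = (\<lambda>a. \<Sum>i=1..n. h i * total_deriv n m r z i a)" and "v \<in> pure_order n m r"
      by (auto simp: horizontal_altdef)
    then have "h i = 0" if "i \<in> {1..n}" for i
      using that pure_order_xc[of v n m r i] by (simp add: sum_total_deriv_xc)
    then show "v \<in> {\<lambda>_. 0}" by (simp add: v)
  next
    fix v :: "coord \<Rightarrow> real" assume "v \<in> {\<lambda>_. 0}"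
    then show "v \<in> horizontal n m r z \<inter> pure_order n m r"
      by (auto simp: horizontal_altdef pure_order_def coord_space_def intro!: exI[of _ "\<lambda>_. 0"])
  qed
qed

lemma horizontal_bij_base:
  assumes "\<And>D. \<tau> D = (\<lambda>b. if b \<in> {1..n} then D (xc b) else 0)"
  shows "bij_betw \<tau> (horizontal n m r z) (coord_space {1..n})"
proof (rule bij_betw_byWitness[where f' = "\<lambda>h a. \<Sum>i=1..n. h i * total_deriv n m r z i a"])
  have \<tau>: "\<tau> (\<lambda>a. \<Sum>i=1..n. h i * total_deriv n m r z i a) = (\<lambda>b. if b \<in> {1..n} then h b else 0)" for h
    unfolding assms sum_total_deriv_xc by (rule ext) simp
  show "\<forall>D\<in>horizontal n m r z. (\<lambda>a. \<Sum>i=1..n. \<tau> D i * total_deriv n m r z i a) = D"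
  proof
    fix D assume "D \<in> horizontal n m r z"
    then obtain h where D: "D = (\<lambda>a. \<Sum>i=1..n. h i * total_deriv n m r z i a)"
      by (auto simp: horizontal_altdef)
    show "(\<lambda>a. \<Sum>i=1..n. \<tau> D i * total_deriv n m r z i a) = D"
      unfolding D \<tau> by (intro ext sum.cong) simp_all
  qed
  show "\<forall>h\<in>coord_space {1..n}. \<tau> (\<lambda>a. \<Sum>i=1..n. h i * total_deriv n m r z i a) = h"
    unfolding \<tau> by (auto simp: coord_space_def)
  show "\<tau> ` horizontal n m r z \<subseteq> coord_space {1..n}"
    unfolding assms coord_space_def by auto
  show "(\<lambda>h a. \<Sum>i=1..n. h i * total_deriv n m r z i a) ` coord_space {1..n} \<subseteq> horizontal n m r z"
    by (auto simp: horizontal_altdef)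
qed


section \<open>Duality of the Reeb frame and the adapted form\<close>

text \<open>
  For \<open>i \<le> l\<close>, the left-hand side is the binomial expansion of \<open>(t - t)\<^sup>l\<^sup>-\<^sup>i\<close> divided by
  \<open>(l - i)!\<close>.
\<close>

lemma sum_exp_inverse:
  fixes t :: real
  shows "(\<Sum>j=i..l. (- t) ^ (l - j) / fact (l - j) * (t ^ (j - i) / fact (j - i))) = (if i = l then 1 else 0)"
proof (cases "i \<le> l")
  case True
  define d where "d = l - i"
  have "(\<Sum>j=i..l. (- t) ^ (l - j) / fact (l - j) * (t ^ (j - i) / fact (j - i))) =
      (\<Sum>k\<le>d. (- t) ^ (d - k) / fact (d - k) * (t ^ k / fact k))"
    by (rule sum.reindex_bij_witness[of _ "\<lambda>k. k + i" "\<lambda>j. j - i"]) (use True in \<open>auto simp: d_def\<close>)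
  also have "\<dots> = (\<Sum>k\<le>d. of_nat (d choose k) * t ^ k * (- t) ^ (d - k)) / fact d"
    by (simp add: sum_divide_distrib binomial_fact) (intro sum.cong refl, simp add: field_simps)
  also have "\<dots> = (t + - t) ^ d / fact d" by (simp only: binomial_ring)
  also have "\<dots> = (if i = l then 1 else 0)" using True by (auto simp: d_def power_0_left)
  finally show ?thesis .
qed auto

definition reeb_coeff :: "nat \<Rightarrow> (coord \<Rightarrow> real) \<Rightarrow> (nat \<Rightarrow> nat) \<Rightarrow> real" where
  "reeb_coeff n z K = mpow n (\<lambda>i. z (xc i)) K / mfact n K"

definition adapted_coeff :: "nat \<Rightarrow> (coord \<Rightarrow> real) \<Rightarrow> (nat \<Rightarrow> nat) \<Rightarrow> real" where
  "adapted_coeff n z K = (- 1) ^ mdeg n K * mpow n (\<lambda>i. z (xc i)) K / mfact n K"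

lemma reeb_coeff_prod: "reeb_coeff n z K = (\<Prod>i=1..n. z (xc i) ^ K i / fact (K i))"
  by (simp add: reeb_coeff_def mpow_def mfact_def prod_dividef)

lemma adapted_coeff_prod: "adapted_coeff n z K = (\<Prod>i=1..n. (- z (xc i)) ^ K i / fact (K i))"
proof -
  have "(\<Prod>i=1..n. (- z (xc i)) ^ K i) = (\<Prod>i=1..n. (- 1) ^ K i * z (xc i) ^ K i)"
    by (intro prod.cong refl) (metis mult_minus1 power_mult_distrib)
  also have "\<dots> = (- 1) ^ mdeg n K * mpow n (\<lambda>i. z (xc i)) K"
    by (simp add: prod.distrib mpow_def mdeg_def power_sum)
  finally show ?thesis by (simp add: adapted_coeff_def prod_dividef mfact_def)
qed

text \<open>
  The sum over the order interval from \<open>I\<close> to \<open>L\<close> is a product of one-variable sums. Hence the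
  triangular matrices of the Reeb frame and of the adapted form are inverse to each other.
\<close>

lemma reeb_adapted_coeff_inverse:
  assumes "I \<in> multi n" "L \<in> multi n"
  shows "(\<Sum>J\<in>{J \<in> multi n. I \<le> J \<and> J \<le> L}. adapted_coeff n z (L - J) * reeb_coeff n z (J - I)) =
    (if I = L then 1 else 0)"
proof -
  let ?f = "\<lambda>i j. (- z (xc i)) ^ (L i - j) / fact (L i - j) * (z (xc i) ^ (j - I i) / fact (j - I i))"
  have "(\<Sum>J\<in>{J \<in> multi n. I \<le> J \<and> J \<le> L}. adapted_coeff n z (L - J) * reeb_coeff n z (J - I)) =
      (\<Sum>J\<in>{J \<in> multi n. I \<le> J \<and> J \<le> L}. \<Prod>i=1..n. ?f i (J i))"
    unfolding reeb_coeff_prod adapted_coeff_prod prod.distrib fun_diff_def ..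
  also have "\<dots> = (\<Sum>J\<in>PiE {1..n} (\<lambda>i. {I i..L i}). \<Prod>i=1..n. ?f i (J i))"
  proof (rule sum.reindex_bij_witness[of _ "\<lambda>J i. if i \<in> {1..n} then J i else 0" "\<lambda>J. restrict J {1..n}"])
    fix J assume "J \<in> {J \<in> multi n. I \<le> J \<and> J \<le> L}"
    then show "(\<lambda>i. if i \<in> {1..n} then restrict J {1..n} i else 0) = J"
      "restrict J {1..n} \<in> PiE {1..n} (\<lambda>i. {I i..L i})"
      by (auto simp: multi_def fun_eq_iff le_fun_def)
  next
    fix J assume J: "J \<in> PiE {1..n} (\<lambda>i. {I i..L i})"
    then show "restrict (\<lambda>i. if i \<in> {1..n} then J i else 0) {1..n} = J"
      by (intro ext) (auto simp: PiE_def extensional_def)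
    have "I i \<le> (if i \<in> {1..n} then J i else 0)" "(if i \<in> {1..n} then J i else 0) \<le> L i" for i
      using PiE_mem[OF J, of i] assms(1) by (auto simp: multi_def)
    then show "(\<lambda>i. if i \<in> {1..n} then J i else 0) \<in> {J \<in> multi n. I \<le> J \<and> J \<le> L}"
      by (auto simp: multi_def le_fun_def)
  next
    fix J
    show "(\<Prod>i=1..n. ?f i (restrict J {1..n} i)) = (\<Prod>i=1..n. ?f i (J i))"
      by (intro prod.cong) auto
  qed
  also have "\<dots> = (\<Prod>i=1..n. \<Sum>j=I i..L i. ?f i j)" by (simp add: prod_sum_PiE)
  also have "\<dots> = (\<Prod>i=1..n. if I i = L i then 1 else 0)" unfolding sum_exp_inverse ..
  also have "\<dots> = (if I = L then 1 else 0)"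
  proof (cases "I = L")
    case False
    then obtain i where i: "I i \<noteq> L i" by (auto simp: fun_eq_iff)
    have "I i = 0 \<and> L i = 0" if "i \<notin> {1..n}"
      using assms that unfolding multi_def by blast
    then have "i \<in> {1..n}" using i by fastforce
    then have "(\<Prod>i=1..n. if I i = L i then 1 else 0 :: real) = 0"
      using i by (intro prod_zero) auto
    then show ?thesis using False by simp
  qed simp
  finally show ?thesis .
qed

text \<open>
  With \<open>T \<alpha> L\<close> the values of the contact forms \<open>\<theta>\<^sup>\<alpha>\<^sub>L\<close> or of their differentials, \<open>c\<close>
  is the value of \<open>\<eta>\<close> or, on Cartan vectors, of \<open>d\<eta>\<close>. The matrix of the Reeb frame is
  inverse to the one that turns \<open>T\<close> into \<open>c\<close>, so it restores \<open>T\<close>.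
\<close>

lemma reeb_lift_adapted:
  assumes c: "\<And>\<alpha> J. (\<alpha>, J) \<in> reeb_index n m r \<Longrightarrow>
    c (\<alpha>, J) = (\<Sum>L\<in>{L \<in> multi_le n (r - 1). J \<le> L}. adapted_coeff n z (L - J) * T \<alpha> L)"
  shows "reeb_lift n m r z c = (\<lambda>a. \<Sum>\<alpha>=1..m. \<Sum>L\<in>multi_le n (r - 1). T \<alpha> L * unit_vec (uc \<alpha> L) a)"
proof
  fix a
  let ?M = "multi_le n (r - 1)"
  let ?f = "\<lambda>\<alpha> J L I. T \<alpha> L * unit_vec (uc \<alpha> I) a * (adapted_coeff n z (L - J) * reeb_coeff n z (J - I))"
  have "(\<Sum>J\<in>?M. c (\<alpha>, J) * reeb_field n z \<alpha> J a) = (\<Sum>L\<in>?M. T \<alpha> L * unit_vec (uc \<alpha> L) a)"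
    if \<alpha>: "\<alpha> \<in> {1..m}" for \<alpha>
  proof -
    have below: "{I \<in> multi n. I \<le> J} = {I \<in> ?M. I \<le> J}" if "J \<in> ?M" for J
      using that mem_multi_le_of_le[OF that] by (auto simp: multi_le_def)
    have "c (\<alpha>, J) * reeb_field n z \<alpha> J a =
        (\<Sum>L\<in>?M. \<Sum>I\<in>?M. if I \<le> J \<and> J \<le> L then ?f \<alpha> J L I else 0)" if J: "J \<in> ?M" for J
    proof -
      have "c (\<alpha>, J) = (\<Sum>L\<in>?M. if J \<le> L then adapted_coeff n z (L - J) * T \<alpha> L else 0)"
        using c[of \<alpha> J] \<alpha> J by (simp add: reeb_index_def sum.inter_filter)
      moreover have "reeb_field n z \<alpha> J a =
          (\<Sum>I\<in>?M. if I \<le> J then reeb_coeff n z (J - I) * unit_vec (uc \<alpha> I) a else 0)"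
        unfolding reeb_field_def below[OF J] 
        by (simp only: sum.inter_filter[OF finite_multi_le] reeb_coeff_def)
      ultimately show ?thesis
        by (simp only:) (subst sum_product, intro sum.cong refl, simp)
    qed
    then have "(\<Sum>J\<in>?M. c (\<alpha>, J) * reeb_field n z \<alpha> J a) =
        (\<Sum>J\<in>?M. \<Sum>L\<in>?M. \<Sum>I\<in>?M. if I \<le> J \<and> J \<le> L then ?f \<alpha> J L I else 0)"
      by (intro sum.cong refl) blast
    also have "\<dots> = (\<Sum>L\<in>?M. \<Sum>J\<in>?M. \<Sum>I\<in>?M. if I \<le> J \<and> J \<le> L then ?f \<alpha> J L I else 0)"
      by (rule sum.swap)
    also have "\<dots> = (\<Sum>L\<in>?M. \<Sum>I\<in>?M. \<Sum>J\<in>?M. if I \<le> J \<and> J \<le> L then ?f \<alpha> J L I else 0)"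
      by (intro sum.cong refl sum.swap)
    also have "\<dots> = (\<Sum>L\<in>?M. \<Sum>I\<in>?M. T \<alpha> L * unit_vec (uc \<alpha> I) a * (if I = L then 1 else 0))"
    proof (intro sum.cong refl)
      fix L I assume L: "L \<in> ?M" and I: "I \<in> ?M"
      have "{J \<in> ?M. I \<le> J \<and> J \<le> L} = {J \<in> multi n. I \<le> J \<and> J \<le> L}"
        using mem_multi_le_of_le[OF L] by (auto simp: multi_le_def)
      then have "(\<Sum>J\<in>?M. if I \<le> J \<and> J \<le> L then ?f \<alpha> J L I else 0) =
          (\<Sum>J\<in>{J \<in> multi n. I \<le> J \<and> J \<le> L}. ?f \<alpha> J L I)"
        by (simp flip: sum.inter_filter)
      also have "\<dots> = T \<alpha> L * unit_vec (uc \<alpha> I) a * (if I = L then 1 else 0)"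
        using reeb_adapted_coeff_inverse[of I n L z] L I
        by (simp only: multi_le_def mem_Collect_eq flip: sum_distrib_left)
      finally show "(\<Sum>J\<in>?M. if I \<le> J \<and> J \<le> L then ?f \<alpha> J L I else 0) =
          T \<alpha> L * unit_vec (uc \<alpha> I) a * (if I = L then 1 else 0)" .
    qed
    also have "\<dots> = (\<Sum>L\<in>?M. \<Sum>I\<in>?M. if L = I then T \<alpha> L * unit_vec (uc \<alpha> I) a else 0)"
      by (intro sum.cong refl) auto
    also have "\<dots> = (\<Sum>L\<in>?M. T \<alpha> L * unit_vec (uc \<alpha> L) a)"
      by (intro sum.cong refl) simp
    finally show ?thesis .
  qed
  then show "reeb_lift n m r z c a = (\<Sum>\<alpha>=1..m. \<Sum>L\<in>?M. T \<alpha> L * unit_vec (uc \<alpha> L) a)"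
    by (simp add: reeb_lift_def reeb_index_def flip: sum.cartesian_product)
qed


section \<open>The exterior derivative of the adapted form\<close>

lemma DERIV_pd:
  assumes "((\<lambda>t. f (z(a := t))) has_real_derivative d) (at (z a))"
  shows "((\<lambda>t. f (z(a := t))) has_real_derivative pd a f z) (at (z a))"
  using assms pd_DERIV[where f = f, OF assms] by simp

lemma DERIV_adapted_coeff:
  "((\<lambda>t. adapted_coeff n (z(a := t)) K) has_real_derivative pd a (\<lambda>z. adapted_coeff n z K) z) (at (z a))"
proof -
  let ?f = "\<lambda>i z. (- z (xc i)) ^ K i / fact (K i)"
  have f: "((\<lambda>t. ?f i (z(a := t))) has_real_derivative pd a (?f i) z) (at (z a))" for i
    by (rule DERIV_pd, rule DERIV_cdivide, rule DERIV_power, rule DERIV_minus, rule DERIV_coord)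
  show ?thesis
    unfolding adapted_coeff_prod by (rule DERIV_pd, rule has_field_derivative_prod, rule f)
qed

lemma contact_form_unit_vec:
  "contact_form n z \<alpha> L (unit_vec b) =
     unit_vec (uc \<alpha> L) b - (\<Sum>i=1..n. z (uc \<alpha> (madd1 L i)) * unit_vec (xc i) b)"
  by (simp add: contact_form_def unit_vec_commute[of b])

lemma DERIV_contact_form:
  "((\<lambda>t. contact_form n (z(a := t)) \<alpha> L (unit_vec b)) has_real_derivative
     - (\<Sum>i=1..n. unit_vec (uc \<alpha> (madd1 L i)) a * unit_vec (xc i) b)) (at (z a))"
  unfolding contact_form_unit_vec
  using DERIV_diff[OF DERIV_const DERIV_sum[OF DERIV_cmult_right[OF DERIV_coord]]] by simp

lemma contact_form_expand:
  assumes "1 \<le> r" "v \<in> coord_space (jet_index n m r)" "\<alpha> \<in> {1..m}" "L \<in> multi_le n (r - 1)"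
  shows "(\<Sum>b\<in>jet_index n m r. contact_form n z \<alpha> L (unit_vec b) * v b) = contact_form n z \<alpha> L v"
proof -
  let ?A = "jet_index n m r"
  have L: "uc \<alpha> L \<in> ?A" using assms(3,4) multi_le_mono[of "r - 1" r n] by auto
  have pick: "(\<Sum>b\<in>?A. v b * unit_vec c b) = v c" if "c \<in> ?A" for c
    using that by (simp add: sum_unit_vec)
  have "(\<Sum>b\<in>?A. contact_form n z \<alpha> L (unit_vec b) * v b) =
      (\<Sum>b\<in>?A. v b * unit_vec (uc \<alpha> L) b) -
      (\<Sum>b\<in>?A. \<Sum>i=1..n. z (uc \<alpha> (madd1 L i)) * (v b * unit_vec (xc i) b))"
    unfolding contact_form_unit_vec sum_subtractf[symmetric]
    by (intro sum.cong refl) (simp add: right_diff_distrib sum_distrib_left mult_ac)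
  also have "(\<Sum>b\<in>?A. \<Sum>i=1..n. z (uc \<alpha> (madd1 L i)) * (v b * unit_vec (xc i) b)) =
      (\<Sum>i=1..n. z (uc \<alpha> (madd1 L i)) * (\<Sum>b\<in>?A. v b * unit_vec (xc i) b))"
    by (subst sum.swap) (simp add: sum_distrib_left)
  also have "\<dots> = (\<Sum>i=1..n. z (uc \<alpha> (madd1 L i)) * v (xc i))"
    by (intro sum.cong refl) (simp add: pick)
  finally show ?thesis using L by (simp add: contact_form_def pick)
qed

text \<open>
  \<open>d(c \<theta>) = dc \<and> \<theta> + c d\<theta>\<close>, where the first term vanishes on the Cartan distribution and
  \<open>d\<theta>\<^sup>\<alpha>\<^sub>L = \<Sum>\<^sub>i dx\<^sup>i \<and> du\<^sup>\<alpha>\<^sub>L\<^sub>+\<^sub>i\<close>. So on Cartan vectors only the contact forms are differentiated.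
\<close>

lemma ext_deriv_adapted_form:
  assumes r: "1 \<le> r"
    and op: "openin (top_of_set (coord_space (jet_index n m r))) (\<phi> ` U)" and p: "p \<in> U"
    and v: "v \<in> cartan n m r (\<phi> p)" and w: "w \<in> cartan n m r (\<phi> p)"
    and k: "(\<alpha>, J) \<in> reeb_index n m r"
  shows "ext_deriv_vec (jet_index n m r) U \<phi> (\<lambda>p. adapted_form n m r (\<phi> p)) p v w (\<alpha>, J) =
    (\<Sum>L\<in>{L \<in> multi_le n (r - 1). J \<le> L}. adapted_coeff n (\<phi> p) (L - J) *
      (\<Sum>i=1..n. v (xc i) * w (uc \<alpha> (madd1 L i)) - w (xc i) * v (uc \<alpha> (madd1 L i))))"
proof -
  let ?A = "jet_index n m r" and ?S = "{L \<in> multi_le n (r - 1). J \<le> L}"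
  let ?c = "\<lambda>z L. adapted_coeff n z (L - J)"
  let ?\<theta> = "\<lambda>z L b. contact_form n z \<alpha> L (unit_vec b)"
  let ?d\<theta> = "\<lambda>L a b. - (\<Sum>i=1..n. unit_vec (uc \<alpha> (madd1 L i)) a * unit_vec (xc i) b)"
  define z where "z = \<phi> p"
  have \<alpha>: "\<alpha> \<in> {1..m}" and finS: "finite ?S" using k by (auto simp: reeb_index_def)
  have finR: "finite (reeb_index n m r)" by (simp add: reeb_index_def)
  have comp: "adapted_form n m r z' (unit_vec b) (\<alpha>, J) = (\<Sum>L\<in>?S. ?c z' L * ?\<theta> z' L b)" for z' b
    using sum_unit_vec(1)[OF finR, of "\<lambda>k. adapted_component n r z' (fst k) (snd k) (unit_vec b)" "(\<alpha>, J)"] k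
    by (simp add: adapted_form_def case_prod_beta adapted_component_def adapted_coeff_def)
  define dc where "dc = (\<lambda>a L. pd a (\<lambda>z. ?c z L) z)"
  have dc: "((\<lambda>t. ?c (z(a := t)) L) has_real_derivative dc a L) (at (z a))" for a L
    unfolding dc_def by (rule DERIV_adapted_coeff)
  have "pd a (\<lambda>z'. adapted_form n m r (\<phi> (inv_into U \<phi> z')) (unit_vec b) (\<alpha>, J)) z =
      (\<Sum>L\<in>?S. dc a L * ?\<theta> z L b + ?c z L * ?d\<theta> L a b)" if "a \<in> ?A" for a b
  proof -
    have "pd a (\<lambda>z'. adapted_form n m r (\<phi> (inv_into U \<phi> z')) (unit_vec b) (\<alpha>, J)) z =
        pd a (\<lambda>z'. \<Sum>L\<in>?S. ?c z' L * ?\<theta> z' L b) z"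
      unfolding z_def by (rule pd_chart[OF op p that]) (rule comp)
    also have "\<dots> = (\<Sum>L\<in>?S. dc a L * ?\<theta> z L b + ?c z L * ?d\<theta> L a b)"
    proof (rule pd_DERIV, rule DERIV_sum)
      fix L
      show "((\<lambda>t. ?c (z(a := t)) L * ?\<theta> (z(a := t)) L b) has_real_derivative
          dc a L * ?\<theta> z L b + ?c z L * ?d\<theta> L a b) (at (z a))"
        using DERIV_mult[OF dc[of a L] DERIV_contact_form[of n z a \<alpha> L b]] by (simp add: mult.commute)
    qed
    finally show ?thesis .
  qed
  then have "ext_deriv_vec ?A U \<phi> (\<lambda>p. adapted_form n m r (\<phi> p)) p v w (\<alpha>, J) =
      (\<Sum>a\<in>?A. \<Sum>b\<in>?A. (\<Sum>L\<in>?S. dc a L * ?\<theta> z L b + ?c z L * ?d\<theta> L a b) * (v a * w b - w a * v b))"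
    by (simp add: ext_deriv_vec_def ext_deriv_def z_def)
  also have "\<dots> = (\<Sum>a\<in>?A. \<Sum>b\<in>?A. \<Sum>L\<in>?S. (dc a L * ?\<theta> z L b + ?c z L * ?d\<theta> L a b) * (v a * w b - w a * v b))"
    by (simp only: sum_distrib_right)
  also have "\<dots> = (\<Sum>a\<in>?A. \<Sum>L\<in>?S. \<Sum>b\<in>?A. (dc a L * ?\<theta> z L b + ?c z L * ?d\<theta> L a b) * (v a * w b - w a * v b))"
    by (intro sum.cong refl sum.swap)
  also have "\<dots> = (\<Sum>L\<in>?S. \<Sum>a\<in>?A. \<Sum>b\<in>?A. (dc a L * ?\<theta> z L b + ?c z L * ?d\<theta> L a b) * (v a * w b - w a * v b))"
    by (rule sum.swap)
  also have "\<dots> = (\<Sum>L\<in>?S. ?c z L *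
      (\<Sum>i=1..n. v (xc i) * w (uc \<alpha> (madd1 L i)) - w (xc i) * v (uc \<alpha> (madd1 L i))))"
  proof (rule sum.cong[OF refl])
    fix L assume "L \<in> ?S"
    then have L: "L \<in> multi_le n (r - 1)" by simp
    have \<theta>0: "(\<Sum>b\<in>?A. ?\<theta> z L b * v b) = 0" "(\<Sum>b\<in>?A. ?\<theta> z L b * w b) = 0"
      using v w \<alpha> L contact_form_expand[OF r _ \<alpha> L] by (auto simp: cartan_def z_def)
    have pick: "(\<Sum>b\<in>?A. u b * unit_vec c b) = u c" if "c \<in> ?A" for c and u :: "coord \<Rightarrow> real"
      using that by (simp add: sum_unit_vec)
    have d\<theta>: "(\<Sum>a\<in>?A. \<Sum>b\<in>?A. ?d\<theta> L a b * (u a * u' b)) =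
        - (\<Sum>i=1..n. u (uc \<alpha> (madd1 L i)) * u' (xc i))" for u u' :: "coord \<Rightarrow> real"
    proof -
      have "(\<Sum>a\<in>?A. \<Sum>b\<in>?A. ?d\<theta> L a b * (u a * u' b)) =
          - (\<Sum>a\<in>?A. \<Sum>b\<in>?A. \<Sum>i=1..n. (u a * unit_vec (uc \<alpha> (madd1 L i)) a) * (u' b * unit_vec (xc i) b))"
        unfolding sum_negf[symmetric]
        by (intro sum.cong refl) (simp add: sum_distrib_right sum_distrib_left mult_ac)
      also have "(\<Sum>a\<in>?A. \<Sum>b\<in>?A. \<Sum>i=1..n. (u a * unit_vec (uc \<alpha> (madd1 L i)) a) * (u' b * unit_vec (xc i) b)) =
          (\<Sum>a\<in>?A. \<Sum>i=1..n. \<Sum>b\<in>?A. (u a * unit_vec (uc \<alpha> (madd1 L i)) a) * (u' b * unit_vec (xc i) b))"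
        by (intro sum.cong refl sum.swap)
      also have "\<dots> = (\<Sum>i=1..n. \<Sum>a\<in>?A. \<Sum>b\<in>?A. (u a * unit_vec (uc \<alpha> (madd1 L i)) a) * (u' b * unit_vec (xc i) b))"
        by (rule sum.swap)
      also have "\<dots> = (\<Sum>i=1..n. u (uc \<alpha> (madd1 L i)) * u' (xc i))"
      proof (rule sum.cong[OF refl])
        fix i assume i: "i \<in> {1..n}"
        then have "uc \<alpha> (madd1 L i) \<in> ?A" using \<alpha> madd1_multi_le[OF r L i] by simp
        then show "(\<Sum>a\<in>?A. \<Sum>b\<in>?A. (u a * unit_vec (uc \<alpha> (madd1 L i)) a) * (u' b * unit_vec (xc i) b)) =
            u (uc \<alpha> (madd1 L i)) * u' (xc i)"
          using i unfolding sum_product[symmetric] by (simp only: pick jet_index_iff)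
      qed
      finally show ?thesis .
    qed
    have "(\<Sum>a\<in>?A. \<Sum>b\<in>?A. (dc a L * ?\<theta> z L b + ?c z L * ?d\<theta> L a b) * (v a * w b - w a * v b)) =
        (\<Sum>a\<in>?A. \<Sum>b\<in>?A. (dc a L * v a) * (?\<theta> z L b * w b)) - (\<Sum>a\<in>?A. \<Sum>b\<in>?A. (dc a L * w a) * (?\<theta> z L b * v b))
        + ?c z L * ((\<Sum>a\<in>?A. \<Sum>b\<in>?A. ?d\<theta> L a b * (v a * w b)) - (\<Sum>a\<in>?A. \<Sum>b\<in>?A. ?d\<theta> L a b * (w a * v b)))"
      unfolding sum_distrib_left right_diff_distrib sum_subtractf[symmetric] sum.distrib[symmetric]
      by (intro sum.cong refl) (simp add: algebra_simps)
    also have "(\<Sum>a\<in>?A. \<Sum>b\<in>?A. (dc a L * v a) * (?\<theta> z L b * w b)) = 0"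
      unfolding sum_product[symmetric] by (simp only: \<theta>0 mult_zero_right)
    also have "(\<Sum>a\<in>?A. \<Sum>b\<in>?A. (dc a L * w a) * (?\<theta> z L b * v b)) = 0"
      unfolding sum_product[symmetric] by (simp only: \<theta>0 mult_zero_right)
    also have "(\<Sum>a\<in>?A. \<Sum>b\<in>?A. ?d\<theta> L a b * (v a * w b)) - (\<Sum>a\<in>?A. \<Sum>b\<in>?A. ?d\<theta> L a b * (w a * v b)) =
        (\<Sum>i=1..n. v (xc i) * w (uc \<alpha> (madd1 L i)) - w (xc i) * v (uc \<alpha> (madd1 L i)))"
      unfolding d\<theta> by (simp add: sum_subtractf mult.commute)
    finally show "(\<Sum>a\<in>?A. \<Sum>b\<in>?A. (dc a L * ?\<theta> z L b + ?c z L * ?d\<theta> L a b) * (v a * w b - w a * v b)) =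
        ?c z L * (\<Sum>i=1..n. v (xc i) * w (uc \<alpha> (madd1 L i)) - w (xc i) * v (uc \<alpha> (madd1 L i)))"
      by (simp only: diff_zero add_0_left)
  qed
  finally show ?thesis by (simp add: z_def)
qed

text \<open>
  For \<open>|L| < r - 1\<close> all \<open>madd1 L i\<close> have order less than \<open>r\<close>, where the components of \<open>B\<close> vanish,
  so only the order \<open>r - 1\<close> survives.
\<close>

lemma reeb_lift_ext_deriv:
  assumes r: "1 \<le> r"
    and op: "openin (top_of_set (coord_space (jet_index n m r))) (\<phi> ` U)" and p: "p \<in> U"
    and D: "D \<in> horizontal n m r (\<phi> p)" and B: "B \<in> pure_order n m r"
  shows "reeb_lift n m r (\<phi> p)
      (ext_deriv_vec (jet_index n m r) U \<phi> (\<lambda>p. adapted_form n m r (\<phi> p)) p D B) =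
    (\<lambda>a. \<Sum>\<alpha>=1..m. \<Sum>I\<in>multi_eq n (r - 1). (\<Sum>i=1..n. D (xc i) * B (uc \<alpha> (madd1 I i))) * unit_vec (uc \<alpha> I) a)"
proof -
  let ?T = "\<lambda>\<alpha> L. \<Sum>i=1..n. D (xc i) * B (uc \<alpha> (madd1 L i))"
  have "reeb_lift n m r (\<phi> p)
      (ext_deriv_vec (jet_index n m r) U \<phi> (\<lambda>p. adapted_form n m r (\<phi> p)) p D B) =
    (\<lambda>a. \<Sum>\<alpha>=1..m. \<Sum>L\<in>multi_le n (r - 1). ?T \<alpha> L * unit_vec (uc \<alpha> L) a)"
    by (rule reeb_lift_adapted)
      (simp add: ext_deriv_adapted_form[OF r op p horizontal_subset_cartan[OF r D] pure_order_subset_cartan[OF r B]]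
        pure_order_xc[OF B])
  moreover have "?T \<alpha> L = 0" if L: "L \<in> multi_le n (r - 1)" "L \<notin> multi_eq n (r - 1)" for \<alpha> L
    using that r madd1_multi_eq_iff[OF r L(1)] by (auto intro!: sum.neutral pure_order_uc[OF B])
  then have "(\<Sum>L\<in>multi_le n (r - 1). ?T \<alpha> L * unit_vec (uc \<alpha> L) a) =
      (\<Sum>L\<in>multi_eq n (r - 1). ?T \<alpha> L * unit_vec (uc \<alpha> L) a)" for \<alpha> a
    by (intro sum.mono_neutral_right finite_multi_le multi_eq_subset) auto
  ultimately show ?thesis by simp
qed


section \<open>Symmetric tensors as functions on words\<close>

text \<open>
  A word \<open>[i, j, \<dots>]\<close> stands for the basis tensor \<open>dx\<^sup>i \<otimes> dx\<^sup>j \<otimes> \<dots>\<close>, and \<open>count_list L\<close>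
  is the multi-index of the word \<open>L\<close>.
\<close>

definition words :: "nat \<Rightarrow> nat \<Rightarrow> nat list set" where
  "words n s = {L. length L = s \<and> set L \<subseteq> {1..n}}"

definition word_tensor :: "(nat \<Rightarrow> real) list \<Rightarrow> nat list \<Rightarrow> real" where
  "word_tensor Xs L = (\<Prod>k<length L. (Xs ! k) (L ! k))"

lemma finite_words [simp]: "finite (words n s)"
  using finite_lists_length_eq[of "{1..n}" s] by (simp add: words_def conj_commute)

lemma words_0: "words n 0 = {[]}"
  by (auto simp: words_def)

lemma words_Suc: "words n (Suc s) = (\<lambda>(i, L). i # L) ` ({1..n} \<times> words n s)"
  by (force simp: words_def length_Suc_conv)

lemma sum_words_Suc: "(\<Sum>L\<in>words n (Suc s). f L) = (\<Sum>i=1..n. \<Sum>L\<in>words n s. f (i # L))"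
  unfolding words_Suc
  by (subst sum.reindex) (auto simp: inj_on_def sum.cartesian_product case_prod_beta)

lemma word_tensor_Nil [simp]: "word_tensor Xs [] = 1"
  by (simp add: word_tensor_def)

lemma word_tensor_Cons [simp]: "word_tensor (X # Xs) (i # L) = X i * word_tensor Xs L"
  unfolding word_tensor_def by (simp add: prod.lessThan_Suc_shift del: prod.lessThan_Suc)

lemma count_list_words:
  assumes "L \<in> words n s"
  shows "count_list L \<in> multi_eq n s"
proof -
  have "mdeg n (count_list L) = (\<Sum>i\<in>set L. count_list L i)"
    unfolding mdeg_def using assms by (intro sum.mono_neutral_right) (auto simp: words_def count_list_0_iff)
  then have "mdeg n (count_list L) = s"
    using assms by (simp add: sum_count_set words_def)
  moreover have "count_list L \<in> multi n"
    using assms by (auto simp: multi_def words_def count_list_0_iff)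
  ultimately show ?thesis by (simp add: multi_eq_def)
qed

lemma count_list_Cons_madd1: "count_list (i # L) = madd1 (count_list L) i"
  by (auto simp: madd1_def fun_eq_iff)

lemma count_list_multi_list:
  assumes "J \<in> multi n"
  shows "count_list (multi_list n J) = J"
proof
  fix i
  have rep: "count_list (replicate k j) i = (if i = j then k else 0)" for k and j :: nat
    by (induction k) auto
  have *: "count_list (concat (map (\<lambda>i. replicate (J i) i) js)) (i :: nat) = (if i \<in> set js then J i else 0)"
    if "distinct js" for js
    using that by (induction js) (auto simp: rep)
  show "count_list (multi_list n J) i = J i"
    using assms *[of "[1..<Suc n]"] by (auto simp: multi_list_def multi_def)
qed

lemma multi_list_words:
  assumes "J \<in> multi_eq n s"
  shows "multi_list n J \<in> words n s"
proof -
  have "set (multi_list n J) \<subseteq> {1..n}" by (auto simp: multi_list_def)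
  moreover have "length (multi_list n J) = mdeg n J"
    by (simp add: multi_list_def mdeg_def length_concat comp_def interv_sum_list_conv_sum_set_nat
      atLeastLessThanSuc_atLeastAtMost del: upt_Suc)
  ultimately show ?thesis using assms by (simp add: words_def multi_eq_def)
qed

lemma mset_eq_iff_count_list: "mset L = mset L' \<longleftrightarrow> count_list L = count_list L'"
  by (simp add: multiset_eq_iff fun_eq_iff count_mset)

text \<open>
  Permuting a list hits each of its rearrangements equally often: the permutations that carry
  \<open>xs\<close> to \<open>ys\<close> form a coset of those that fix \<open>xs\<close>. Counting all permutations gives the
  multiplicity.
\<close>

lemma sum_permute_list:
  fixes g :: "'a list \<Rightarrow> real"
  shows "(\<Sum>\<sigma>\<in>{\<sigma>. \<sigma> permutes {..<length xs}}. g (permute_list \<sigma> xs)) =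
    (\<Prod>a\<in>set xs. fact (count_list xs a)) * (\<Sum>ys\<in>permutations_of_multiset (mset xs). g ys)"
proof -
  let ?P = "{\<sigma>. \<sigma> permutes {..<length xs}}" and ?R = "permutations_of_multiset (mset xs)"
  let ?fib = "\<lambda>ys. {\<sigma> \<in> ?P. permute_list \<sigma> xs = ys}"
  have finP: "finite ?P" by (simp add: finite_permutations)
  have img: "(\<lambda>\<sigma>. permute_list \<sigma> xs) ` ?P \<subseteq> ?R"
    by (auto simp: permutations_of_multiset_def)
  have fib: "card (?fib ys) = card (?fib xs)" if "ys \<in> ?R" for ys
  proof -
    from that have "mset ys = mset xs" by (simp add: permutations_of_multiset_def)
    then obtain p where p: "p permutes {..<length xs}" "permute_list p xs = ys"
      by (rule mset_eq_permutation)
    have "bij_betw (\<lambda>\<sigma>. \<sigma> \<circ> p) (?fib xs) (?fib ys)"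
    proof (rule bij_betw_byWitness[where f' = "\<lambda>\<sigma>. \<sigma> \<circ> inv p"])
      show "\<forall>\<sigma>\<in>?fib xs. \<sigma> \<circ> p \<circ> inv p = \<sigma>" "\<forall>\<sigma>\<in>?fib ys. \<sigma> \<circ> inv p \<circ> p = \<sigma>"
        using p by (simp_all add: comp_assoc permutes_inv_o)
      show "(\<lambda>\<sigma>. \<sigma> \<circ> p) ` ?fib xs \<subseteq> ?fib ys"
        using p by (auto simp: permute_list_compose intro: permutes_compose)
      have "permute_list (inv p) ys = xs"
        using permute_list_compose[of "inv p" xs p] p by (simp add: permutes_inv permutes_inv_o)
      then show "(\<lambda>\<sigma>. \<sigma> \<circ> inv p) ` ?fib ys \<subseteq> ?fib xs"
        using p by (auto simp: permute_list_compose permutes_inv intro: permutes_compose)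
    qed
    then show ?thesis by (rule bij_betw_same_card[symmetric])
  qed
  have all: "(\<Sum>\<sigma>\<in>?P. h (permute_list \<sigma> xs)) = real (card (?fib xs)) * (\<Sum>ys\<in>?R. h ys)"
    for h :: "'a list \<Rightarrow> real"
  proof -
    have "(\<Sum>\<sigma>\<in>?P. h (permute_list \<sigma> xs)) = (\<Sum>ys\<in>?R. \<Sum>\<sigma>\<in>?fib ys. h (permute_list \<sigma> xs))"
      by (rule sum.group[OF finP _ img, symmetric]) simp
    also have "\<dots> = (\<Sum>ys\<in>?R. real (card (?fib xs)) * h ys)"
    proof (rule sum.cong[OF refl])
      fix ys assume "ys \<in> ?R"
      moreover have "(\<Sum>\<sigma>\<in>?fib ys. h (permute_list \<sigma> xs)) = (\<Sum>\<sigma>\<in>?fib ys. h ys)"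
        by (rule sum.cong) auto
      ultimately show "(\<Sum>\<sigma>\<in>?fib ys. h (permute_list \<sigma> xs)) = real (card (?fib xs)) * h ys"
        by (simp only: sum_constant fib)
    qed
    finally show ?thesis by (simp add: sum_distrib_left)
  qed
  have "real (card ?P) = real (card (?fib xs)) * real (card ?R)"
    using all[of "\<lambda>_. 1"] by simp
  moreover have "card ?P = fact (length xs)" by (simp add: card_permutations)
  moreover have "fact (length xs) = card ?R * (\<Prod>a\<in>set xs. fact (count_list xs a))"
    using card_permutations_of_multiset_aux[of "mset xs"] by (simp add: count_mset)
  moreover have "card ?R \<noteq> 0" by simp
  ultimately have "card (?fib xs) = (\<Prod>a\<in>set xs. fact (count_list xs a))"
    by (simp flip: of_nat_mult)
  then have "real (card (?fib xs)) = (\<Prod>a\<in>set xs. fact (count_list xs a))" by simp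
  then show ?thesis using all[of g] by simp
qed

text \<open>
  Each word with multi-index \<open>J\<close> arises from exactly \<open>J!\<close> permutations of \<open>multi_list n J\<close>, which
  cancels the factor \<open>1 / J!\<close>.
\<close>

lemma sym_dx_words:
  assumes J: "J \<in> multi_eq n s" and Xs: "length Xs = s"
  shows "sym_dx n J Xs = (\<Sum>L\<in>{L \<in> words n s. count_list L = J}. word_tensor Xs L)"
proof -
  let ?l = "multi_list n J" and ?P = "{\<sigma>. \<sigma> permutes {..<s}}"
  have l: "length ?l = s" "set ?l \<subseteq> {1..n}" "count_list ?l = J"
    and s: "mdeg n J = s" and Jm: "J \<in> multi n"
    using multi_list_words[OF J] J count_list_multi_list by (auto simp: words_def multi_eq_def)
  have "(\<Sum>\<sigma>\<in>?P. \<Prod>k<s. (Xs ! \<sigma> k) (?l ! k)) = (\<Sum>\<sigma>\<in>?P. \<Prod>k<s. (Xs ! inv \<sigma> k) (?l ! k))"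
    by (rule sum_permutations_inverse)
  also have "\<dots> = (\<Sum>\<sigma>\<in>?P. word_tensor Xs (permute_list \<sigma> ?l))"
  proof (rule sum.cong[OF refl])
    fix \<sigma> assume "\<sigma> \<in> ?P"
    then have \<sigma>: "\<sigma> permutes {..<s}" by simp
    have "(\<Prod>k<s. (Xs ! inv \<sigma> k) (?l ! k)) = (\<Prod>k<s. (Xs ! inv \<sigma> (\<sigma> k)) (?l ! \<sigma> k))"
      using prod.permute[OF \<sigma>, of "\<lambda>k. (Xs ! inv \<sigma> k) (?l ! k)"] by (simp add: comp_def)
    also have "\<dots> = word_tensor Xs (permute_list \<sigma> ?l)"
      unfolding word_tensor_def using \<sigma> l(1)
      by (simp add: permute_list_nth permutes_inverses(2)[OF \<sigma>])
    finally show "(\<Prod>k<s. (Xs ! inv \<sigma> k) (?l ! k)) = word_tensor Xs (permute_list \<sigma> ?l)" .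
  qed
  also have "\<dots> = (\<Prod>a\<in>set ?l. fact (count_list ?l a)) *
      (\<Sum>L\<in>permutations_of_multiset (mset ?l). word_tensor Xs L)"
    using sum_permute_list[of "word_tensor Xs" ?l] unfolding l(1) .
  also have "(\<Prod>a\<in>set ?l. fact (count_list ?l a)) = mfact n J"
  proof -
    have "J a = 0" if "a \<notin> set ?l" for a
      using that count_list_0_iff[of ?l a] unfolding l(3) by blast
    then show ?thesis
      unfolding mfact_def l(3) using l(2) by (intro prod.mono_neutral_left) auto
  qed
  also have "permutations_of_multiset (mset ?l) = {L \<in> words n s. count_list L = J}"
  proof -
    have "L \<in> words n s" if "mset L = mset ?l" for L
      using l(1,2) mset_eq_length[OF that] mset_eq_setD[OF that] by (simp add: words_def)
    then show ?thesis
      using l(3) by (auto simp: permutations_of_multiset_def mset_eq_iff_count_list)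
  qed
  finally have "(\<Sum>\<sigma>\<in>?P. \<Prod>k<s. (Xs ! \<sigma> k) (?l ! k)) =
      mfact n J * (\<Sum>L\<in>{L \<in> words n s. count_list L = J}. word_tensor Xs L)" .
  moreover have "mfact n J \<noteq> 0" by (simp add: mfact_def)
  ultimately show ?thesis by (simp add: sym_dx_def s)
qed

text \<open>
  Every word has exactly one multi-index, so the sum over multi-indices of sums over words is one
  sum over words. In this form, inserting a vector in the first argument splits off the first letter.
\<close>

lemma sym_ident_words:
  assumes "Xs \<in> tangent_tuples n s"
  shows "sym_ident n m s v Xs (uc \<alpha> (\<lambda>_. 0)) =
    (if \<alpha> \<in> {1..m} then \<Sum>L\<in>words n s. v (uc \<alpha> (count_list L)) * word_tensor Xs L else 0)"
proof -
  have len: "length Xs = s" using assms by (simp add: tangent_tuples_def)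
  have "sym_ident n m s v Xs (uc \<alpha> (\<lambda>_. 0)) =
      (\<Sum>\<beta>=1..m. if \<alpha> = \<beta> then \<Sum>I\<in>multi_eq n s. v (uc \<alpha> I) * sym_dx n I Xs else 0)"
  proof -
    have "(\<Sum>I\<in>multi_eq n s. v (uc \<beta> I) * sym_dx n I Xs * unit_vec (uc \<beta> (\<lambda>_. 0)) (uc \<alpha> (\<lambda>_. 0))) =
        (if \<alpha> = \<beta> then \<Sum>I\<in>multi_eq n s. v (uc \<alpha> I) * sym_dx n I Xs else 0)" for \<beta>
      by (simp add: unit_vec_def)
    then show ?thesis using assms by (simp add: sym_ident_def)
  qed
  also have "\<dots> = (if \<alpha> \<in> {1..m} then \<Sum>I\<in>multi_eq n s. v (uc \<alpha> I) * sym_dx n I Xs else 0)"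
    by simp
  also have "(\<Sum>I\<in>multi_eq n s. v (uc \<alpha> I) * sym_dx n I Xs) =
      (\<Sum>I\<in>multi_eq n s. \<Sum>L\<in>{L \<in> words n s. count_list L = I}. v (uc \<alpha> (count_list L)) * word_tensor Xs L)"
    by (intro sum.cong refl) (simp add: sym_dx_words[OF _ len] sum_distrib_left)
  also have "\<dots> = (\<Sum>L\<in>words n s. v (uc \<alpha> (count_list L)) * word_tensor Xs L)"
    by (rule sum.group) (auto intro: count_list_words)
  finally show ?thesis .
qed

lemma sym_ident_other:
  assumes "Xs \<in> tangent_tuples n s" "\<nexists>\<alpha>. \<alpha> \<in> {1..m} \<and> a = uc \<alpha> (\<lambda>_. 0)"
  shows "sym_ident n m s v Xs a = 0"
  using assms by (auto simp: sym_ident_def unit_vec_def intro!: sum.neutral)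

lemma unit_vec_coord_space: "i \<in> A \<Longrightarrow> unit_vec i \<in> coord_space A"
  by (auto simp: unit_vec_def coord_space_def)

lemma basis_tuple: "L \<in> words n s \<Longrightarrow> map unit_vec L \<in> tangent_tuples n s"
  by (auto simp: words_def tangent_tuples_def intro!: unit_vec_coord_space)

lemma word_tensor_basis:
  assumes "length L = length K"
  shows "word_tensor (map unit_vec L) K = (if K = L then 1 else 0)"
  using assms
proof (induction L K rule: list_induct2)
  case (Cons i L j K)
  then show ?case by (auto simp: unit_vec_def)
qed simp

lemma sym_ident_basis:
  assumes L: "L \<in> words n s" and "\<alpha> \<in> {1..m}"
  shows "sym_ident n m s v (map unit_vec L) (uc \<alpha> (\<lambda>_. 0)) = v (uc \<alpha> (count_list L))"
proof -
  have "sym_ident n m s v (map unit_vec L) (uc \<alpha> (\<lambda>_. 0)) =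
      (\<Sum>K\<in>words n s. if K = L then v (uc \<alpha> (count_list K)) else 0)"
  proof -
    have "word_tensor (map unit_vec L) K = (if K = L then 1 else 0)" if "K \<in> words n s" for K
      using L that by (intro word_tensor_basis) (simp add: words_def)
    then show ?thesis
      using assms(2) unfolding sym_ident_words[OF basis_tuple[OF L]]
      by (simp del: sum.delta sum.delta') (intro sum.cong refl, simp)
  qed
  then show ?thesis using L by simp
qed

text \<open>
  The arguments are expanded in the basis one after the other; \<open>Ps\<close> holds those slots in which
  basis vectors have already been inserted.
\<close>

lemma multilinear_expand:
  assumes lin: "\<And>Xs k X X' c d. Xs \<in> tangent_tuples n s \<Longrightarrow> k < s \<Longrightarrow> X \<in> coord_space {1..n} \<Longrightarrow>
      X' \<in> coord_space {1..n} \<Longrightarrow>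
      f (Xs[k := (\<lambda>i. c * X i + d * X' i)]) = c * f (Xs[k := X]) + d * f (Xs[k := X'] :: (nat \<Rightarrow> real) list)"
    and "Ps @ Xs \<in> tangent_tuples n s"
  shows "f (Ps @ Xs) = (\<Sum>L\<in>words n (length Xs). (f (Ps @ map unit_vec L) :: real) * word_tensor Xs L)"
  using assms(2)
proof (induction Xs arbitrary: Ps)
  case Nil
  then show ?case by (simp add: words_0)
next
  case (Cons X Xs)
  have tup: "Ps @ Y # Xs \<in> tangent_tuples n s" if "Y \<in> coord_space {1..n}" for Y
    using Cons.prems that by (auto simp: tangent_tuples_def)
  have lin': "f (Ps @ (\<lambda>i. c * Y i + d * Y' i) # Xs) = c * f (Ps @ Y # Xs) + d * f (Ps @ Y' # Xs)"
    if "Y \<in> coord_space {1..n}" "Y' \<in> coord_space {1..n}" for Y Y' c d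
    using lin[OF Cons.prems _ that, of "length Ps" c d] Cons.prems
    by (simp add: tangent_tuples_def)
  have X: "X \<in> coord_space {1..n}" using Cons.prems by (simp add: tangent_tuples_def)
  (* Linearity is given for two summands; the basis expansion of X is built up over S. *)
  have part: "f (Ps @ (\<lambda>i. if i \<in> S then X i else 0) # Xs) = (\<Sum>i\<in>S. X i * f (Ps @ unit_vec i # Xs))"
    if "S \<subseteq> {1..n}" for S
    using finite_subset[OF that finite_atLeastAtMost] that
  proof (induction S rule: finite_induct)
    case empty
    have "(\<lambda>_. 0) \<in> coord_space {1..n}" by (simp add: coord_space_def)
    from lin'[OF this this, of 0 0] show ?case by simp
  next
    case (insert j S)
    let ?Y = "\<lambda>i. if i \<in> S then X i else 0"
    have "?Y \<in> coord_space {1..n}" using X by (auto simp: coord_space_def)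
    moreover have "unit_vec j \<in> coord_space {1..n}" using insert.prems by (intro unit_vec_coord_space) simp
    moreover have "(\<lambda>i. if i \<in> insert j S then X i else 0) = (\<lambda>i. 1 * ?Y i + X j * unit_vec j i)"
      using insert.hyps by (auto simp: unit_vec_def)
    ultimately have "f (Ps @ (\<lambda>i. if i \<in> insert j S then X i else 0) # Xs) =
        f (Ps @ ?Y # Xs) + X j * f (Ps @ unit_vec j # Xs)"
      using lin'[of ?Y "unit_vec j" 1 "X j"] by simp
    then show ?case using insert by simp
  qed
  have "(\<lambda>i. if i \<in> {1..n} then X i else 0) = X" using X by (auto simp: coord_space_def)
  then have "f (Ps @ X # Xs) = (\<Sum>i=1..n. X i * f (Ps @ unit_vec i # Xs))"
    using part[OF subset_refl] by simp
  also have "\<dots> = (\<Sum>i=1..n. \<Sum>L\<in>words n (length Xs). f (Ps @ map unit_vec (i # L)) * word_tensor (X # Xs) (i # L))"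
  proof (rule sum.cong[OF refl])
    fix i assume "i \<in> {1..n}"
    then have "(Ps @ [unit_vec i]) @ Xs \<in> tangent_tuples n s"
      using tup[OF unit_vec_coord_space] by simp
    from Cons.IH[OF this]
    show "X i * f (Ps @ unit_vec i # Xs) =
        (\<Sum>L\<in>words n (length Xs). f (Ps @ map unit_vec (i # L)) * word_tensor (X # Xs) (i # L))"
      by (simp add: sum_distrib_left mult_ac)
  qed
  also have "\<dots> = (\<Sum>L\<in>words n (length (X # Xs)). f (Ps @ map unit_vec L) * word_tensor (X # Xs) L)"
    by (simp add: sum_words_Suc)
  finally show ?case .
qed

lemma word_tensor_linear:
  assumes "k < length L" "length Xs = length L"
  shows "word_tensor (Xs[k := (\<lambda>i. c * X i + d * X' i)]) L =
    c * word_tensor (Xs[k := X]) L + d * word_tensor (Xs[k := X']) L"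
proof -
  have *: "word_tensor (Xs[k := Y]) L = Y (L ! k) * (\<Prod>j\<in>{..<length L} - {k}. (Xs ! j) (L ! j))" for Y
  proof -
    have "word_tensor (Xs[k := Y]) L = (Xs[k := Y] ! k) (L ! k) * (\<Prod>j\<in>{..<length L} - {k}. (Xs[k := Y] ! j) (L ! j))"
      unfolding word_tensor_def using assms by (intro prod.remove) auto
    also have "(\<Prod>j\<in>{..<length L} - {k}. (Xs[k := Y] ! j) (L ! j)) = (\<Prod>j\<in>{..<length L} - {k}. (Xs ! j) (L ! j))"
      by (intro prod.cong) auto
    finally show ?thesis using assms by simp
  qed
  show ?thesis unfolding * by (simp add: algebra_simps)
qed

lemma pure_order_0_iff:
  "w \<in> pure_order n m 0 \<longleftrightarrow> (\<forall>a. (\<nexists>\<alpha>. \<alpha> \<in> {1..m} \<and> a = uc \<alpha> (\<lambda>_. 0)) \<longrightarrow> w a = 0)"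
proof -
  have "multi_eq n 0 = {\<lambda>_. 0}"
    using multi_le_0[of n] by (simp add: multi_eq_def multi_le_def)
  then have "{uc \<alpha> I | \<alpha> I. \<alpha> \<in> {1..m} \<and> I \<in> multi_eq n 0} = {a. \<exists>\<alpha>. \<alpha> \<in> {1..m} \<and> a = uc \<alpha> (\<lambda>_. 0)}"
    by auto
  then show ?thesis by (auto simp: pure_order_def coord_space_def)
qed

lemma sym_ident_sym_tensors: "sym_ident n m s v \<in> sym_tensors n s (pure_order n m 0)"
proof -
  have upd: "Xs[k := Y] \<in> tangent_tuples n s"
    if "Xs \<in> tangent_tuples n s" "Y \<in> coord_space {1..n}" for Xs k Y
    using that set_update_subset_insert[of Xs k Y] by (auto simp: tangent_tuples_def)
  have "sym_ident n m s v \<in> tangent_tuples n s \<rightarrow>\<^sub>E pure_order n m 0"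
  proof (rule PiE_I)
    fix Xs assume "Xs \<in> tangent_tuples n s"
    then show "sym_ident n m s v Xs \<in> pure_order n m 0"
      using sym_ident_other unfolding pure_order_0_iff by blast
  qed (simp add: sym_ident_def)
  moreover have "sym_ident n m s v (permute_list \<sigma> Xs) = sym_ident n m s v Xs"
    if Xs: "Xs \<in> tangent_tuples n s" and \<sigma>: "\<sigma> permutes {..<s}" for Xs \<sigma>
  proof -
    have len: "length Xs = s" using Xs by (simp add: tangent_tuples_def)
    have "permute_list \<sigma> Xs \<in> tangent_tuples n s"
      using Xs \<sigma> len by (simp add: tangent_tuples_def)
    moreover have "sym_dx n I (permute_list \<sigma> Xs) = sym_dx n I Xs" if "I \<in> multi_eq n s" for I
    proof -
      have s: "mdeg n I = s" using that by (simp add: multi_eq_def)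
      have "(\<Sum>\<rho>\<in>{\<rho>. \<rho> permutes {..<s}}. \<Prod>k<s. (permute_list \<sigma> Xs ! \<rho> k) (multi_list n I ! k)) =
          (\<Sum>\<rho>\<in>{\<rho>. \<rho> permutes {..<s}}. \<Prod>k<s. (Xs ! (\<sigma> \<circ> \<rho>) k) (multi_list n I ! k))"
      proof (intro sum.cong prod.cong refl)
        fix \<rho> k assume "\<rho> \<in> {\<rho>. \<rho> permutes {..<s}}" "k \<in> {..<s}"
        then have "\<rho> k < s" using permutes_in_image[of \<rho> "{..<s}" k] by simp
        then show "(permute_list \<sigma> Xs ! \<rho> k) (multi_list n I ! k) = (Xs ! (\<sigma> \<circ> \<rho>) k) (multi_list n I ! k)"
          using \<sigma> len by (simp add: permute_list_nth)
      qed
      also have "\<dots> = (\<Sum>\<rho>\<in>{\<rho>. \<rho> permutes {..<s}}. \<Prod>k<s. (Xs ! \<rho> k) (multi_list n I ! k))"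
        by (rule setum_permutations_compose_left[OF \<sigma>, symmetric])
      finally show ?thesis by (simp add: sym_dx_def s)
    qed
    ultimately show ?thesis using Xs by (simp add: sym_ident_def)
  qed
  moreover have "sym_ident n m s v (Xs[k := (\<lambda>i. c * X i + d * X' i)]) =
      (\<lambda>a. c * sym_ident n m s v (Xs[k := X]) a + d * sym_ident n m s v (Xs[k := X']) a)"
    if Xs: "Xs \<in> tangent_tuples n s" and k: "k < s" and X: "X \<in> coord_space {1..n}"
      and X': "X' \<in> coord_space {1..n}" for Xs k X X' c d
  proof
    fix a
    have XX: "(\<lambda>i. c * X i + d * X' i) \<in> coord_space {1..n}" using X X' by (simp add: coord_space_def)
    show "sym_ident n m s v (Xs[k := (\<lambda>i. c * X i + d * X' i)]) a =
      c * sym_ident n m s v (Xs[k := X]) a + d * sym_ident n m s v (Xs[k := X']) a"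
    proof (cases "\<exists>\<alpha>. \<alpha> \<in> {1..m} \<and> a = uc \<alpha> (\<lambda>_. 0)")
      case True
      then obtain \<alpha> where \<alpha>: "\<alpha> \<in> {1..m}" "a = uc \<alpha> (\<lambda>_. 0)" by blast
      have "word_tensor (Xs[k := (\<lambda>i. c * X i + d * X' i)]) L =
          c * word_tensor (Xs[k := X]) L + d * word_tensor (Xs[k := X']) L" if "L \<in> words n s" for L
        using that k Xs by (intro word_tensor_linear) (auto simp: words_def tangent_tuples_def)
      then show ?thesis
        unfolding \<alpha>(2) sym_ident_words[OF upd[OF Xs XX]] sym_ident_words[OF upd[OF Xs X]]
          sym_ident_words[OF upd[OF Xs X']]
        using \<alpha>(1) by (simp add: sum_distrib_left sum.distrib algebra_simps cong: sum.cong)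
    next
      case False
      then show ?thesis
        using sym_ident_other[OF upd[OF Xs XX]] sym_ident_other[OF upd[OF Xs X]]
          sym_ident_other[OF upd[OF Xs X']] by simp
    qed
  qed
  ultimately show ?thesis unfolding sym_tensors_def by blast
qed

text \<open>
  The inverse reads off the component with multi-index \<open>I\<close> at the basis tuple
  \<open>multi_list n I\<close>; by symmetry any other word with this multi-index gives the same value.
\<close>

lemma sym_ident_bij: "bij_betw (sym_ident n m s) (pure_order n m s) (sym_tensors n s (pure_order n m 0))"
proof -
  define g where "g B a = (case a of xc _ \<Rightarrow> 0 | uc \<alpha> I \<Rightarrow>
      if \<alpha> \<in> {1..m} \<and> I \<in> multi_eq n s then B (map unit_vec (multi_list n I)) (uc \<alpha> (\<lambda>_. 0)) else 0)"
    for B :: "(nat \<Rightarrow> real) list \<Rightarrow> coord \<Rightarrow> real" and a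
  show ?thesis
  proof (rule bij_betw_byWitness[where f' = g])
    show "\<forall>v\<in>pure_order n m s. g (sym_ident n m s v) = v"
    proof
      fix v assume v: "v \<in> pure_order n m s"
      show "g (sym_ident n m s v) = v"
      proof
        fix a
        show "g (sym_ident n m s v) a = v a"
        proof (cases a)
          case (uc \<alpha> I)
          have "sym_ident n m s v (map unit_vec (multi_list n I)) (uc \<alpha> (\<lambda>_. 0)) = v (uc \<alpha> I)"
            if "\<alpha> \<in> {1..m}" "I \<in> multi_eq n s"
            using sym_ident_basis[OF multi_list_words[OF that(2)] that(1)] that(2)
            by (simp add: multi_eq_def count_list_multi_list)
          then show ?thesis using uc pure_order_uc[OF v, of \<alpha> I] by (auto simp: g_def)
        qed (simp add: g_def pure_order_xc[OF v])
      qed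
    qed
  next
    show "\<forall>B\<in>sym_tensors n s (pure_order n m 0). sym_ident n m s (g B) = B"
    proof
      fix B assume B: "B \<in> sym_tensors n s (pure_order n m 0)"
      then have BE: "B \<in> tangent_tuples n s \<rightarrow>\<^sub>E pure_order n m 0" by (simp add: sym_tensors_def)
      show "sym_ident n m s (g B) = B"
      proof (rule PiE_ext[OF _ BE])
        show "sym_ident n m s (g B) \<in> tangent_tuples n s \<rightarrow>\<^sub>E pure_order n m 0"
          using sym_ident_sym_tensors by (auto simp: sym_tensors_def)
        fix Xs assume Xs: "Xs \<in> tangent_tuples n s"
        then have len: "length Xs = s" by (simp add: tangent_tuples_def)
        show "sym_ident n m s (g B) Xs = B Xs"
        proof
          fix a
          show "sym_ident n m s (g B) Xs a = B Xs a"
          proof (cases "\<exists>\<alpha>. \<alpha> \<in> {1..m} \<and> a = uc \<alpha> (\<lambda>_. 0)")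
            case True
            then obtain \<alpha> where \<alpha>: "\<alpha> \<in> {1..m}" and a: "a = uc \<alpha> (\<lambda>_. 0)" by blast
            have "B (map unit_vec (multi_list n (count_list L))) = B (map unit_vec L)"
              if L: "L \<in> words n s" for L
            proof -
              let ?K = "multi_list n (count_list L)"
              have "mset ?K = mset L"
                using count_list_words[OF L]
                by (simp add: mset_eq_iff_count_list count_list_multi_list multi_eq_def)
              then obtain \<sigma> where "\<sigma> permutes {..<length L}" "permute_list \<sigma> L = ?K"
                by (rule mset_eq_permutation)
              moreover from this have "permute_list \<sigma> (map unit_vec L) = map unit_vec ?K"
                using permute_list_map[of \<sigma> L unit_vec] by simp
              ultimately show ?thesis
                using B basis_tuple[OF L] L unfolding sym_tensors_def words_def by fastforce
            qed
            then have "sym_ident n m s (g B) Xs a = (\<Sum>L\<in>words n s. B (map unit_vec L) a * word_tensor Xs L)"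
              unfolding a sym_ident_words[OF Xs] using \<alpha> count_list_words
              by (auto simp: g_def intro!: sum.cong)
            also have "\<dots> = B Xs a"
              using multilinear_expand[of n s "\<lambda>Xs. B Xs a" "[]" Xs] Xs len B
              by (simp add: sym_tensors_def)
            finally show ?thesis .
          next
            case False
            then show ?thesis
              using PiE_mem[OF BE Xs] sym_ident_other[OF Xs False] by (simp add: pure_order_0_iff)
          qed
        qed
      qed
    qed
  next
    show "sym_ident n m s ` pure_order n m s \<subseteq> sym_tensors n s (pure_order n m 0)"
      using sym_ident_sym_tensors by blast
    show "g ` sym_tensors n s (pure_order n m 0) \<subseteq> pure_order n m s"
    proof
      fix v assume "v \<in> g ` sym_tensors n s (pure_order n m 0)"
      then obtain B where v: "v = g B" by blast
      have "g B a = 0" if "a \<notin> {uc \<alpha> I | \<alpha> I. \<alpha> \<in> {1..m} \<and> I \<in> multi_eq n s}" for a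
        using that by (cases a) (auto simp: g_def)
      then show "v \<in> pure_order n m s" by (simp add: v pure_order_def coord_space_def)
    qed
  qed
qed

text \<open>
  The first letter \<open>i\<close> of a word \<open>i # L\<close> of length \<open>r\<close> is evaluated on \<open>h\<close>, and the multi-index of
  \<open>i # L\<close> is \<open>madd1 (count_list L) i\<close>.
\<close>

lemma spencer_contraction_sym_ident:
  assumes r: "1 \<le> r" and h: "h \<in> coord_space {1..n}"
    and v: "\<And>\<alpha> I. \<alpha> \<in> {1..m} \<Longrightarrow> I \<in> multi_eq n (r - 1) \<Longrightarrow> v (uc \<alpha> I) = (\<Sum>i=1..n. h i * B (uc \<alpha> (madd1 I i)))"
  shows "spencer_contraction n r h (sym_ident n m r B) = sym_ident n m (r - 1) v"
proof
  fix Xs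
  obtain s where s: "r = Suc s" using r by (cases r) auto
  show "spencer_contraction n r h (sym_ident n m r B) Xs = sym_ident n m (r - 1) v Xs"
  proof (cases "Xs \<in> tangent_tuples n s")
    case True
    then have hXs: "h # Xs \<in> tangent_tuples n (Suc s)" using h by (simp add: tangent_tuples_def)
    have "sym_ident n m (Suc s) B (h # Xs) a = sym_ident n m s v Xs a" for a
    proof (cases "\<exists>\<alpha>. \<alpha> \<in> {1..m} \<and> a = uc \<alpha> (\<lambda>_. 0)")
      case \<alpha>: True
      then obtain \<alpha> where \<alpha>: "\<alpha> \<in> {1..m}" and a: "a = uc \<alpha> (\<lambda>_. 0)" by blast
      have "sym_ident n m (Suc s) B (h # Xs) a =
          (\<Sum>i=1..n. \<Sum>L\<in>words n s. B (uc \<alpha> (madd1 (count_list L) i)) * (h i * word_tensor Xs L))"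
        unfolding a sym_ident_words[OF hXs] sum_words_Suc word_tensor_Cons count_list_Cons_madd1
        using \<alpha> by simp
      also have "\<dots> = (\<Sum>L\<in>words n s. \<Sum>i=1..n. B (uc \<alpha> (madd1 (count_list L) i)) * (h i * word_tensor Xs L))"
        by (rule sum.swap)
      also have "\<dots> = (\<Sum>L\<in>words n s. v (uc \<alpha> (count_list L)) * word_tensor Xs L)"
      proof (rule sum.cong[OF refl])
        fix L assume "L \<in> words n s"
        then have "v (uc \<alpha> (count_list L)) = (\<Sum>i=1..n. h i * B (uc \<alpha> (madd1 (count_list L) i)))"
          using v[OF \<alpha>] count_list_words by (simp add: s)
        then show "(\<Sum>i=1..n. B (uc \<alpha> (madd1 (count_list L) i)) * (h i * word_tensor Xs L)) =
            v (uc \<alpha> (count_list L)) * word_tensor Xs L"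
          by (simp add: sum_distrib_left sum_distrib_right mult_ac)
      qed
      finally show ?thesis unfolding a sym_ident_words[OF True] using \<alpha> by simp
    next
      case False
      then show ?thesis using sym_ident_other[OF hXs False] sym_ident_other[OF True False] by simp
    qed
    then show ?thesis using True by (auto simp: spencer_contraction_def s)
  qed (simp add: spencer_contraction_def sym_ident_def s)
qed


section \<open>Tangent maps in adapted coordinates\<close>

lemma jet_space_rep:
  assumes "j \<in> jet_space F r"
  shows "local_section_at F (jet_base j) (jet_rep j)"
proof -
  obtain q \<sigma> where j: "j = jet_of F r q \<sigma>" "local_section_at F q \<sigma>"
    using assms by (auto simp: jet_space_def)
  then have "\<sigma> \<in> snd j" by (auto simp: jet_of_def jet_equiv_def split: prod.splits)
  then have "jet_rep j \<in> snd j" unfolding jet_rep_def by (rule someI)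
  then show ?thesis using j(1) by (simp add: jet_of_def jet_base_def)
qed

text \<open>
  The representative chosen for the projected jet may differ from the one chosen for \<open>j\<close>, but
  it has the same derivatives of order up to \<open>s\<close> in the given fibred chart.
\<close>

lemma jet_coords_proj:
  assumes "j \<in> jet_space F r" "jet_total j \<in> W" "fibred_chart F (W, y) (V, x)" "s \<le> r"
    and b: "b \<in> jet_index (base_dim F) (fibre_dim F) s"
  shows "jet_coords F s y (V, x) (jet_proj F s j) b = jet_coords F r y (V, x) j b"
proof -
  let ?q = "jet_base j" and ?j' = "jet_proj F s j"
  have base: "jet_base ?j' = ?q" by (simp add: jet_proj_def jet_of_def jet_base_def)
  have "jet_rep j \<in> snd ?j'"
    using jet_space_rep[OF assms(1)] by (auto simp: jet_proj_def jet_of_def jet_equiv_def split: prod.splits)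
  then have "jet_rep ?j' \<in> snd ?j'" unfolding jet_rep_def[of ?j'] by (rule someI)
  then have eq: "jet_equiv F s ?q (jet_rep j) (jet_rep ?j')"
    by (simp add: jet_proj_def jet_of_def)
  have "snd (jet_rep j) ?q \<in> W" using assms(2) by (simp add: jet_total_def)
  with eq assms(3) have derivs: "section_deriv F y (V, x) (snd (jet_rep j)) \<alpha> I ?q =
      section_deriv F y (V, x) (snd (jet_rep ?j')) \<alpha> I ?q"
    if "\<alpha> \<in> {1..fibre_dim F}" "I \<in> multi_le (base_dim F) s" for \<alpha> I
    using that unfolding jet_equiv_def case_prod_beta by simp
  show ?thesis
  proof (cases b)
    case (xc i)
    then show ?thesis using b by (simp add: jet_coords_def base)
  next
    case (uc \<alpha> I)
    then have "\<alpha> \<in> {1..fibre_dim F}" "I \<in> multi_le (base_dim F) s" using b by simp_all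
    moreover from this have "I \<in> multi_le (base_dim F) r" using multi_le_mono[OF assms(4)] by blast
    ultimately show ?thesis using uc derivs by (simp add: jet_coords_def base)
  qed
qed

lemma jet_base_tangent_eq:
  assumes "adapted_domain F r (W, y) (V, x) U" "p \<in> U"
  shows "jet_base_tangent F r y (V, x) U p D = (\<lambda>b. if b \<in> {1..base_dim F} then D (xc b) else 0)"
  unfolding jet_base_tangent_def
  by (rule tangent_map_forget_coords)
    (use assms in \<open>auto simp: adapted_domain_def jet_coords_def\<close>)

lemma kernel_forget_coords:
  "{v \<in> coord_space A. (\<lambda>b. if b \<in> B then v (\<kappa> b) else 0) = (\<lambda>_. 0)} = coord_space (A - \<kappa> ` B)"
proof (intro equalityI subsetI)
  fix v assume "v \<in> {v \<in> coord_space A. (\<lambda>b. if b \<in> B then v (\<kappa> b) else 0) = (\<lambda>_. 0)}"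
  then have v: "v \<in> coord_space A" and 0: "(\<lambda>b. if b \<in> B then v (\<kappa> b) else 0) = (\<lambda>_. 0)" by auto
  have "v (\<kappa> b) = 0" if "b \<in> B" for b
    using fun_cong[OF 0, of b] that by simp
  then show "v \<in> coord_space (A - \<kappa> ` B)" using v by (auto simp: coord_space_def)
next
  fix v assume "v \<in> coord_space (A - \<kappa> ` B)"
  then show "v \<in> {v \<in> coord_space A. (\<lambda>b. if b \<in> B then v (\<kappa> b) else 0) = (\<lambda>_. 0)}"
    by (auto simp: coord_space_def)
qed

lemma jet_vertical_eq:
  assumes "1 \<le> r" "adapted_domain F r (W, y) (V, x) U" "p \<in> U"
  shows "jet_vertical F r y (V, x) U p = pure_order (base_dim F) (fibre_dim F) r"
proof -
  let ?n = "base_dim F" and ?m = "fibre_dim F"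
  have tm: "tangent_map (jet_index ?n ?m r) U (jet_coords F r y (V, x)) (jet_index ?n ?m (r - 1))
      (jet_coords F (r - 1) y (V, x)) (jet_proj F (r - 1)) p v =
      (\<lambda>b. if b \<in> jet_index ?n ?m (r - 1) then v (id b) else 0)" for v
  proof (rule tangent_map_forget_coords)
    show "openin (top_of_set (coord_space (jet_index ?n ?m r))) (jet_coords F r y (V, x) ` U)" "p \<in> U"
      using assms by (auto simp: adapted_domain_def)
    show "jet_coords F (r - 1) y (V, x) (jet_proj F (r - 1) q) b = jet_coords F r y (V, x) q (id b)"
      if "q \<in> U" "b \<in> jet_index ?n ?m (r - 1)" for q b
      using that assms(2) jet_coords_proj[of q F r W y V x "r - 1" b] by (auto simp: adapted_domain_def)
    show "id ` jet_index ?n ?m (r - 1) \<subseteq> jet_index ?n ?m r"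
      using multi_le_mono[of "r - 1" r ?n] by (auto simp: jet_index_def)
  qed simp
  have "{uc \<alpha> I | \<alpha> I. \<alpha> \<in> {1..?m} \<and> I \<in> multi_eq ?n r} = jet_index ?n ?m r - jet_index ?n ?m (r - 1)"
    unfolding multi_eq_conv_le[OF assms(1)] jet_index_def by auto
  moreover have "jet_vertical F r y (V, x) U p = coord_space (jet_index ?n ?m r - id ` jet_index ?n ?m (r - 1))"
    unfolding jet_vertical_def tm by (rule kernel_forget_coords)
  ultimately show ?thesis by (simp only: pure_order_def image_id id_apply)
qed

lemma vertical_space_eq:
  assumes "fibred_manifold F" "fibred_chart F (W, y) (V, x)" "e \<in> W"
  shows "vertical_space F (W, y) (V, x) e = pure_order (base_dim F) (fibre_dim F) 0"
proof -
  let ?n = "base_dim F" and ?m = "fibre_dim F"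
  have tm: "tangent_map (total_index F) W y (base_index F) x (projection F) e v =
      (\<lambda>b. if b \<in> base_index F then v (xc b) else 0)" for v
  proof (rule tangent_map_forget_coords)
    have "is_chart (total_index F) (total_topology F) (W, y)"
    proof -
      have "smooth_manifold (total_index F) (total_topology F) (total_atlas F)"
        using assms(1) unfolding fibred_manifold_def by (elim conjE)
      then have "\<forall>c\<in>total_atlas F. is_chart (total_index F) (total_topology F) c"
        unfolding smooth_manifold_def by (elim conjE)
      moreover have "(W, y) \<in> total_atlas F" using assms(2) by (simp add: fibred_chart_def)
      ultimately show ?thesis by (rule bspec)
    qed
    then show "openin (top_of_set (coord_space (total_index F))) (y ` W)" by (simp add: is_chart_def)
    show "x (projection F q) b = y q (xc b)" if "q \<in> W" "b \<in> base_index F" for q b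
      using that assms(2) by (simp add: fibred_chart_def)
  qed (use assms(3) in auto)
  have "multi_eq ?n 0 = multi_le ?n 0" by (simp add: multi_eq_def multi_le_def)
  then have "{uc \<alpha> I | \<alpha> I. \<alpha> \<in> {1..?m} \<and> I \<in> multi_eq ?n 0} = total_index F - xc ` base_index F"
    unfolding jet_index_def by auto
  moreover have "vertical_space F (W, y) (V, x) e = coord_space (total_index F - xc ` base_index F)"
    unfolding vertical_space_def case_prod_conv tm by (rule kernel_forget_coords)
  ultimately show ?thesis by (simp only: pure_order_def)
qed


section \<open>The Reeb lift as Spencer contraction\<close>

theorem theorem6p2:
  fixes F :: "('q, 'e) fibration" and n m r :: nat
    and W :: "'e set" and y :: "'e \<Rightarrow> coord \<Rightarrow> real"
    and V :: "'q set" and x :: "'q \<Rightarrow> nat \<Rightarrow> real"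
    and U :: "('q, 'e) jet set"
  assumes "fibred_manifold F" and "base_dim F = n" and "fibre_dim F = m" and "1 \<le> r"
    and "adapted_domain F r (W, y) (V, x) U"
  shows
    "let A = jet_index n m r;
         \<phi> = jet_coords F r y (V, x);
         H = (\<lambda>p. horizontal n m r (\<phi> p));
         G = jet_vertical F r y (V, x) U;
         RL = (\<lambda>p. reeb_lift n m r (\<phi> p));
         d\<eta> = ext_deriv_vec A U \<phi> (\<lambda>p. adapted_form n m r (\<phi> p))
     in
       (\<forall>p\<in>U. is_direct_sum (cartan n m r (\<phi> p)) (H p) (G p)) \<and>
       (\<forall>hv\<in>smooth_sections A U \<phi> H. \<forall>Av\<in>smooth_sections A U \<phi> G. \<forall>h Ac.
          (\<forall>p\<in>U. hv p = (\<lambda>a. \<Sum>i=1..n. h i p * total_deriv n m r (\<phi> p) i a)) \<longrightarrow>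
          (\<forall>p\<in>U. Av p = (\<lambda>a. \<Sum>\<alpha>=1..m. \<Sum>K\<in>multi_eq n r. Ac \<alpha> K p * unit_vec (uc \<alpha> K) a)) \<longrightarrow>
          (\<forall>p\<in>U. RL p (d\<eta> p (hv p) (Av p)) =
             (\<lambda>a. \<Sum>\<alpha>=1..m. \<Sum>I\<in>multi_eq n (r - 1).
                (\<Sum>i=1..n. h i p * Ac \<alpha> (madd1 I i) p) * unit_vec (uc \<alpha> I) a))) \<and>
       (\<forall>p\<in>U.
          let VJ = lin_span ({1..m} \<times> multi_eq n (r - 1)) (\<lambda>(\<alpha>, J). unit_vec (uc \<alpha> J));
              TQ = coord_space {1..n};
              Ve = vertical_space F (W, y) (V, x) (jet_total p);
              \<tau> = jet_base_tangent F r y (V, x) U p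
          in
            bij_betw \<tau> (H p) TQ \<and>
            bij_betw (sym_ident n m r) (G p) (sym_tensors n r Ve) \<and>
            bij_betw (sym_ident n m (r - 1)) VJ (sym_tensors n (r - 1) Ve) \<and>
            (\<forall>D\<in>H p. \<forall>B\<in>G p.
               RL p (d\<eta> p D B) \<in> VJ \<and>
               sym_ident n m (r - 1) (RL p (d\<eta> p D B)) =
                 spencer_contraction n r (\<tau> D) (sym_ident n m r B)))"
proof -
  note [simp] = assms(2,3)
  have r: "1 \<le> r" by fact
  let ?A = "jet_index n m r" and ?\<phi> = "jet_coords F r y (V, x)"
  let ?L = "\<lambda>p D B. reeb_lift n m r (?\<phi> p)
    (ext_deriv_vec ?A U ?\<phi> (\<lambda>p. adapted_form n m r (?\<phi> p)) p D B)"
  have op: "openin (top_of_set (coord_space ?A)) (?\<phi> ` U)" and fc: "fibred_chart F (W, y) (V, x)"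
    and U: "\<And>p. p \<in> U \<Longrightarrow> jet_total p \<in> W"
    using assms(5) by (auto simp: adapted_domain_def)
  have G: "jet_vertical F r y (V, x) U p = pure_order n m r" if "p \<in> U" for p
    using jet_vertical_eq[OF r assms(5) that] by simp
  have Ve: "vertical_space F (W, y) (V, x) (jet_total p) = pure_order n m 0" if "p \<in> U" for p
    using vertical_space_eq[OF assms(1) fc U[OF that]] by simp
  have \<tau>: "jet_base_tangent F r y (V, x) U p D = (\<lambda>b. if b \<in> {1..n} then D (xc b) else 0)"
    if "p \<in> U" for p D
    using jet_base_tangent_eq[OF assms(5) that] by simp
  have L: "?L p D B = (\<lambda>a. \<Sum>\<alpha>=1..m. \<Sum>I\<in>multi_eq n (r - 1).
      (\<Sum>i=1..n. D (xc i) * B (uc \<alpha> (madd1 I i))) * unit_vec (uc \<alpha> I) a)"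
    if "p \<in> U" "D \<in> horizontal n m r (?\<phi> p)" "B \<in> pure_order n m r" for p D B
    by (rule reeb_lift_ext_deriv[OF r op that])
  have part1: "is_direct_sum (cartan n m r (?\<phi> p)) (horizontal n m r (?\<phi> p)) (jet_vertical F r y (V, x) U p)"
    if "p \<in> U" for p
    unfolding G[OF that] by (rule cartan_splitting[OF r])
  have part2: "?L p D B = (\<lambda>a. \<Sum>\<alpha>=1..m. \<Sum>I\<in>multi_eq n (r - 1).
      (\<Sum>i=1..n. h i * b \<alpha> (madd1 I i)) * unit_vec (uc \<alpha> I) a)"
    if p: "p \<in> U" and mem: "D \<in> horizontal n m r (?\<phi> p)" "B \<in> jet_vertical F r y (V, x) U p"
      and D: "D = (\<lambda>a. \<Sum>i=1..n. h i * total_deriv n m r (?\<phi> p) i a)"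
      and B: "B = (\<lambda>a. \<Sum>\<alpha>=1..m. \<Sum>K\<in>multi_eq n r. b \<alpha> K * unit_vec (uc \<alpha> K) a)"
    for p D B h b
  proof -
    have "D (xc i) * B (uc \<alpha> (madd1 I i)) = h i * b \<alpha> (madd1 I i)"
      if "i \<in> {1..n}" "\<alpha> \<in> {1..m}" "I \<in> multi_eq n (r - 1)" for i \<alpha> I
      using that madd1_multi_eq[OF r that(3,1)]
      unfolding D B sum_total_deriv_xc sum_unit_vec_uc[OF finite_multi_eq] by simp
    then show ?thesis
      using L[OF p mem(1) mem(2)[unfolded G[OF p]]] by (auto intro!: sum.cong)
  qed
  have part3: "?L p D B \<in> pure_order n m (r - 1) \<and>
      sym_ident n m (r - 1) (?L p D B) =
        spencer_contraction n r (jet_base_tangent F r y (V, x) U p D) (sym_ident n m r B)"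
    if p: "p \<in> U" and D: "D \<in> horizontal n m r (?\<phi> p)" and B: "B \<in> pure_order n m r" for p D B
  proof
    show "?L p D B \<in> pure_order n m (r - 1)"
      unfolding L[OF p D B] sum_unit_vec_uc[OF finite_multi_eq]
      by (auto simp: pure_order_def coord_space_def split: coord.splits)
    show "sym_ident n m (r - 1) (?L p D B) =
        spencer_contraction n r (jet_base_tangent F r y (V, x) U p D) (sym_ident n m r B)"
      unfolding \<tau>[OF p]
    proof (rule spencer_contraction_sym_ident[symmetric, OF r])
      show "?L p D B (uc \<alpha> I) = (\<Sum>i=1..n. (if i \<in> {1..n} then D (xc i) else 0) * B (uc \<alpha> (madd1 I i)))"
        if "\<alpha> \<in> {1..m}" "I \<in> multi_eq n (r - 1)" for \<alpha> I
        unfolding L[OF p D B] sum_unit_vec_uc[OF finite_multi_eq] using that by simp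
    qed (simp add: coord_space_def)
  qed
  show ?thesis
    unfolding Let_def lin_span_pure_order
  proof (intro conjI ballI allI impI)
    fix p assume p: "p \<in> U"
    show "is_direct_sum (cartan n m r (?\<phi> p)) (horizontal n m r (?\<phi> p)) (jet_vertical F r y (V, x) U p)"
      by (rule part1[OF p])
    show "bij_betw (jet_base_tangent F r y (V, x) U p) (horizontal n m r (?\<phi> p)) (coord_space {1..n})"
      by (rule horizontal_bij_base) (rule \<tau>[OF p])
    show "bij_betw (sym_ident n m r) (jet_vertical F r y (V, x) U p)
        (sym_tensors n r (vertical_space F (W, y) (V, x) (jet_total p)))"
      unfolding G[OF p] Ve[OF p] by (rule sym_ident_bij)
    show "bij_betw (sym_ident n m (r - 1)) (pure_order n m (r - 1))
        (sym_tensors n (r - 1) (vertical_space F (W, y) (V, x) (jet_total p)))"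
      unfolding Ve[OF p] by (rule sym_ident_bij)
    fix D B assume "D \<in> horizontal n m r (?\<phi> p)" "B \<in> jet_vertical F r y (V, x) U p"
    then show "?L p D B \<in> pure_order n m (r - 1)"
      "sym_ident n m (r - 1) (?L p D B) =
        spencer_contraction n r (jet_base_tangent F r y (V, x) U p D) (sym_ident n m r B)"
      using part3[OF p] unfolding G[OF p] by blast+
  next
    fix hv Av h Ac p
    assume hvS: "hv \<in> smooth_sections ?A U ?\<phi> (\<lambda>p. horizontal n m r (?\<phi> p))"
      and AvS: "Av \<in> smooth_sections ?A U ?\<phi> (jet_vertical F r y (V, x) U)"
      and hv: "\<forall>p\<in>U. hv p = (\<lambda>a. \<Sum>i=1..n. h i p * total_deriv n m r (?\<phi> p) i a)"
      and Av: "\<forall>p\<in>U. Av p = (\<lambda>a. \<Sum>\<alpha>=1..m. \<Sum>K\<in>multi_eq n r. Ac \<alpha> K p * unit_vec (uc \<alpha> K) a)"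
      and p: "p \<in> U"
    have "hv p \<in> horizontal n m r (?\<phi> p)" "Av p \<in> jet_vertical F r y (V, x) U p"
      using hvS AvS p unfolding smooth_sections_def by blast+
    from part2[OF p this, of "\<lambda>i. h i p" "\<lambda>\<alpha> K. Ac \<alpha> K p", OF bspec[OF hv p] bspec[OF Av p]]
    show "?L p (hv p) (Av p) = (\<lambda>a. \<Sum>\<alpha>=1..m. \<Sum>I\<in>multi_eq n (r - 1).
        (\<Sum>i=1..n. h i p * Ac \<alpha> (madd1 I i) p) * unit_vec (uc \<alpha> I) a)" .
  qed
qed

end
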